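(* Let $\Pi$ be a stationary and isotropic Poisson line process in $\mathbb{R}^2$ of unit intensity. For $m>0$ let $v_i,v_j\in\mathbb{R}^2$ be two fixed points at distance $m$ apart, let $\mathcal{C}(v_i,v_j)$ be the cell containing $v_i$ and $v_j$ of the partition of the plane produced by the lines of $\Pi$ that remain after deleting all lines of $\Pi$ which separate $v_i$ from $v_j$, and let $J_m=\mathbb{E}\left[\operatorname{len}\partial\mathcal{C}(v_i,v_j)\right]-2m$ be the mean perimeter excess length. Then $$J_m\le O(\log m)\qquad\text{as } m\to\infty .$$
   Context: Undirected lines in the plane are parametrised by $(r,\theta)\in\mathbb{R}\times[0,\pi)$, where $r$ is the signed distance from the line to a reference point and $\theta$ is the angle the line makes with a reference axis. A Poisson line process is a Poisson point process on this parameter space; it is stationary and isotropic if its intensity measure is invariant under translations and rotations of $\mathbb{R}^2$, and has unit intensity if the number of lines hitting a given segment of unit length has expectation $1$. $\operatorname{len}\partial\mathcal{C}$ denotes the perimeter (boundary length) of the cell $\mathcal{C}$. By stationarity and isotropy $J_m$ depends only on $m$. *)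

theory Defs
  imports "HOL-Probability.Probability"
begin

section \<open>Length of plane sets\<close>

text \<open>
  The one-dimensional Hausdorff measure. It is normalised so that a segment has its usual
  length. The covering sets are required to be bounded because \<^const>\<open>diameter\<close> is
  meaningless on unbounded sets.
\<close>

definition hausdorff1_pre :: "real \<Rightarrow> 'a::metric_space set \<Rightarrow> ennreal" where
  "hausdorff1_pre \<delta> A =
     Inf {(\<Sum>i. ennreal (diameter (U i))) | U :: nat \<Rightarrow> 'a set.
            A \<subseteq> (\<Union>i. U i) \<and> (\<forall>i. bounded (U i) \<and> diameter (U i) \<le> \<delta>)}"

definition hausdorff1 :: "'a::metric_space set \<Rightarrow> ennreal" where
  "hausdorff1 A = (SUP \<delta>\<in>{0<..}. hausdorff1_pre \<delta> A)"


section \<open>Poisson point processes\<close>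

definition num_points :: "('w \<Rightarrow> 's set) \<Rightarrow> 's set \<Rightarrow> 'w \<Rightarrow> ennreal" where
  "num_points X B \<omega> = emeasure (count_space UNIV) (X \<omega> \<inter> B)"

text \<open>
  A point process is represented by its random, locally finite set of points, so it has no
  multiple points; a Poisson process with a non-atomic intensity measure has none almost surely.
  The Poisson law is written out explicitly since \<^const>\<open>poisson_pmf\<close> is only specified
  for a positive rate.
\<close>

locale poisson_point_process = prob_space M
  for M :: "'w measure" and \<mu> :: "'s::metric_space measure" and X :: "'w \<Rightarrow> 's set" +
  assumes points_in_space: "\<omega> \<in> space M \<Longrightarrow> X \<omega> \<subseteq> space \<mu>"
    and locally_finite: "\<omega> \<in> space M \<Longrightarrow> bounded B \<Longrightarrow> finite (X \<omega> \<inter> B)"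
    and intensity_locally_finite: "B \<in> sets \<mu> \<Longrightarrow> bounded B \<Longrightarrow> emeasure \<mu> B < \<infinity>"
    and num_points_measurable: "B \<in> sets \<mu> \<Longrightarrow> num_points X B \<in> borel_measurable M"
    and num_points_poisson:
      "B \<in> sets \<mu> \<Longrightarrow> emeasure \<mu> B < \<infinity> \<Longrightarrow>
         prob {\<omega> \<in> space M. num_points X B \<omega> = of_nat k} =
           measure \<mu> B ^ k / fact k * exp (- measure \<mu> B)"
    and num_points_indep:
      "range A \<subseteq> sets \<mu> \<Longrightarrow> disjoint_family A \<Longrightarrow>
         indep_vars (\<lambda>_::nat. borel) (\<lambda>i. num_points X (A i)) UNIV"


section \<open>Lines in the plane\<close>

text \<open>
  The line at signed distance \<open>r\<close> from the origin making the angle \<open>\<theta>\<close> with the first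
  coordinate axis: its direction is \<open>(cos \<theta>, sin \<theta>)\<close>, its unit normal \<open>(- sin \<theta>, cos \<theta>)\<close>.
\<close>

definition line_of :: "real \<times> real \<Rightarrow> (real^2) set" where
  "line_of = (\<lambda>(r, \<theta>). {x. x \<bullet> vector [- sin \<theta>, cos \<theta>] = r})"

definition line_space :: "(real \<times> real) measure" where
  "line_space = restrict_space borel (UNIV \<times> {0..<pi})"

text \<open>
  Invariance of a measure on the parameter space under a map \<open>T\<close> of the plane that takes lines
  to lines: the set whose measure is taken on the left is the preimage of \<open>B\<close> under the
  map which \<open>T\<close> induces on line parameters.
\<close>

definition invariant_under :: "(real \<times> real) measure \<Rightarrow> (real^2 \<Rightarrow> real^2) \<Rightarrow> bool" where
  "invariant_under \<mu> T \<longleftrightarrow>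
     (\<forall>B\<in>sets \<mu>. emeasure \<mu> {p \<in> space \<mu>. T ` line_of p \<in> line_of ` B} = emeasure \<mu> B)"

locale poisson_line_process = poisson_point_process M \<mu> L
  for M :: "'w measure" and \<mu> :: "(real \<times> real) measure" and L :: "'w \<Rightarrow> (real \<times> real) set" +
  assumes sets_intensity: "sets \<mu> = sets line_space"

locale stationary_isotropic_poisson_line_process = poisson_line_process +
  assumes translation_invariant: "invariant_under \<mu> (\<lambda>x. a + x)"
    and rotation_invariant: "rotation_matrix (Q :: real^2^2) \<Longrightarrow> invariant_under \<mu> (\<lambda>x. Q *v x)"

definition unit_intensity :: "'w measure \<Rightarrow> ('w \<Rightarrow> (real \<times> real) set) \<Rightarrow> bool" where
  "unit_intensity M L \<longleftrightarrow>
     (\<forall>x y. dist x y = 1 \<longrightarrow>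
        (\<integral>\<^sup>+\<omega>. num_points L {p. line_of p \<inter> closed_segment x y \<noteq> {}} \<omega> \<partial>M) = 1)"


section \<open>The cell of two points\<close>

definition separates :: "(real^2) set \<Rightarrow> real^2 \<Rightarrow> real^2 \<Rightarrow> bool" where
  "separates l v w \<longleftrightarrow> v \<notin> l \<and> w \<notin> l \<and> l \<inter> closed_segment v w \<noteq> {}"

definition cell :: "(real \<times> real) set \<Rightarrow> real^2 \<Rightarrow> real^2 \<Rightarrow> (real^2) set" where
  "cell P v w =
     connected_component_set (- (\<Union>p\<in>{p \<in> P. \<not> separates (line_of p) v w}. line_of p)) v"

text \<open>
  The expectation of the nonnegative random variable \<open>len \<partial>C\<close> is a Lebesgue integral with
  values in \<open>[0, \<infinity>]\<close>, so that an upper bound on the excess includes finiteness of the expectation.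
\<close>

definition mean_perimeter_excess ::
    "'w measure \<Rightarrow> ('w \<Rightarrow> (real \<times> real) set) \<Rightarrow> real^2 \<Rightarrow> real^2 \<Rightarrow> ereal" where
  "mean_perimeter_excess M L v w =
     enn2ereal (\<integral>\<^sup>+\<omega>. hausdorff1 (frontier (cell (L \<omega>) v w)) \<partial>M) - ereal (2 * dist v w)"

end

theory Submission
  imports Defs
begin

text \<open>
  Write \<open>w = v + m e\<close> with a unit vector \<open>e\<close>, and describe points by their coordinate \<open>x\<close> along \<open>e\<close>,
  counted from \<open>v\<close>, and their height \<open>s\<close> above the line through \<open>v\<close> and \<open>w\<close>. The bound combines a
  probabilistic estimate for single points with the convexity of the cell.

  A point \<open>z\<close> lies in the cell only if no line of the process has \<open>v\<close> and \<open>w\<close> on one side and \<open>z\<close> on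
  the other. By Crofton's formula the lines that do so have measure
  \<open>(|v - z| + |w - z| - m) / 2\<close>. Hence \<open>z\<close> lies in the cell with a probability that decays
  exponentially in this quantity. At coordinate \<open>x\<close> and height \<open>s\<close> it is at least of order \<open>s\<^sup>2 / x\<close>
  when \<open>s\<close> is small compared to \<open>x\<close>, and the height \<open>Y x\<close> of the cell over \<open>x\<close> satisfies
  \<open>E (Y x)\<^sup>2 = O(x)\<close>; by symmetry also \<open>E (Y x)\<^sup>2 = O(m - x)\<close>.

  Convexity turns heights into slopes. Between \<open>v\<close> and \<open>w\<close> the boundary above the segment is the graph of
  a nonnegative concave function, whose slope at \<open>x\<close> lies between \<open>- Y x / (m - x)\<close> and \<open>Y x / x\<close>.
  A graph of slope \<open>k\<close> is longer than its projection by a factor at most \<open>1 + k\<^sup>2 / 2\<close>, and the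
  expected squared slope is \<open>O(1 / x + 1 / (m - x))\<close>. Summed over \<open>1 \<le> x \<le> m - 1\<close> on both sides of the
  segment, this gives an excess \<open>O(log m)\<close> over \<open>2 (m - 2)\<close>.

  The remaining two caps, where \<open>x \<le> 1\<close> or \<open>x \<ge> m - 1\<close>, have bounded expected length:
  a convex curve in a disc of radius \<open>\<rho>\<close> is no longer than the circle, and the cap leaves that disc with
  probability exponentially small in \<open>\<rho>\<close>. For the latter a finite net of directions suffices, because
  the estimate for points persists for balls whose radius is a small multiple of \<open>\<rho>\<close>.

  The geometric half of this is \<open>hausdorff1_frontier_le\<close>, the estimate for points and balls is
  \<open>prob_uncut_le\<close>, and they are combined in \<open>mean_perimeter_le\<close>. An additive error in Crofton's
  formula changes these probabilities by a constant factor, and such factors only affect the constant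
  in \<open>O(log m)\<close>; so the formula is proved up to an additive constant. The random perimeter
  is dominated by a countable sum of indicators of events that certain sets contain no line of the process.
  This reduces the expectation to probabilities \<open>exp (- \<mu> B)\<close>, and it makes
  the dominating function measurable; the perimeter itself is only compared with it pointwise.
\<close>

section \<open>Length of Lipschitz images and of convex curves\<close>

lemma hausdorff1_mono:
  assumes "A \<subseteq> B"
  shows "hausdorff1 A \<le> hausdorff1 B"
  unfolding hausdorff1_def hausdorff1_pre_def
  using assms by (intro SUP_mono' Inf_superset_mono) blast

lemma hausdorff1_pre_Un_le:
  "hausdorff1_pre \<delta> (A \<union> B) \<le> hausdorff1_pre \<delta> A + hausdorff1_pre \<delta> B"
proof -
  define cov where "cov A = {U :: nat \<Rightarrow> 'a set. A \<subseteq> (\<Union>i. U i) \<and>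
    (\<forall>i. bounded (U i) \<and> diameter (U i) \<le> \<delta>)}" for A
  define len where "len U = (\<Sum>i. ennreal (diameter (U i)))" for U :: "nat \<Rightarrow> 'a set"
  have pre: "hausdorff1_pre \<delta> A = (INF U\<in>cov A. len U)" for A
    unfolding hausdorff1_pre_def cov_def len_def by (rule arg_cong[where f = Inf]) auto
  have "hausdorff1_pre \<delta> (A \<union> B) \<le> len U + len V" if U: "U \<in> cov A" and V: "V \<in> cov B" for U V
  proof -
    \<comment> \<open>Interleave the two coverings.\<close>
    define W where "W i = (if even i then U (i div 2) else V (i div 2))" for i
    have W2: "W (2 * i) = U i" "W (2 * i + 1) = V i" for i
      by (auto simp: W_def)
    have "(\<Union>i. U i) \<union> (\<Union>i. V i) \<subseteq> (\<Union>i. W i)"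
      using W2 by (metis (no_types, lifting) UN_I UNIV_I UN_least Un_least subsetI)
    then have "A \<union> B \<subseteq> (\<Union>i. W i)"
      using U V unfolding cov_def by blast
    then have "W \<in> cov (A \<union> B)"
      using U V by (simp add: cov_def W_def)
    have "(\<lambda>i. ennreal (diameter (W (i * 2))) + ennreal (diameter (W (i * 2 + 1)))) sums len W"
    proof -
      have "(\<lambda>n. sum (\<lambda>i. ennreal (diameter (W i))) {n * 2..<n * 2 + 2}) sums len W"
        unfolding len_def by (rule sums_group) auto
      then show ?thesis
        by (simp add: numeral_2_eq_2)
    qed
    then have "len W = (\<Sum>i. ennreal (diameter (U i)) + ennreal (diameter (V i)))"
      using W2 by (auto simp: mult.commute sums_unique)
    also have "\<dots> = len U + len V"
      unfolding len_def by (simp add: suminf_add)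
    finally show ?thesis
      using \<open>W \<in> cov (A \<union> B)\<close> unfolding pre by (metis INF_lower)
  qed
  then have le: "hausdorff1_pre \<delta> (A \<union> B) \<le> len U + len V" if "U \<in> cov A" "V \<in> cov B" for U V
    using that by blast
  show ?thesis
  proof (rule ennreal_le_epsilon)
    fix e :: real
    assume fin: "hausdorff1_pre \<delta> A + hausdorff1_pre \<delta> B < top" and "0 < e"
    then have "hausdorff1_pre \<delta> A < hausdorff1_pre \<delta> A + ennreal (e / 2)"
      "hausdorff1_pre \<delta> B < hausdorff1_pre \<delta> B + ennreal (e / 2)"
      by (auto simp: ennreal_add_left_cancel_less)
    then obtain U V where U: "U \<in> cov A" "len U < hausdorff1_pre \<delta> A + ennreal (e / 2)"
      and V: "V \<in> cov B" "len V < hausdorff1_pre \<delta> B + ennreal (e / 2)"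
      unfolding pre INF_less_iff by blast
    have "len U + len V \<le> (hausdorff1_pre \<delta> A + ennreal (e / 2)) + (hausdorff1_pre \<delta> B + ennreal (e / 2))"
      using U V by (intro add_mono less_imp_le)
    also have "\<dots> = hausdorff1_pre \<delta> A + hausdorff1_pre \<delta> B + ennreal (e / 2 + e / 2)"
      using \<open>0 < e\<close> by (subst ennreal_plus) (auto simp: ac_simps)
    finally show "hausdorff1_pre \<delta> (A \<union> B) \<le> hausdorff1_pre \<delta> A + hausdorff1_pre \<delta> B + ennreal e"
      using le[OF U(1) V(1)] by simp
  qed
qed

lemma hausdorff1_Un_le: "hausdorff1 (A \<union> B) \<le> hausdorff1 A + hausdorff1 B"
  unfolding hausdorff1_def
proof (rule SUP_least)
  fix \<delta> :: real assume \<delta>: "\<delta> \<in> {0<..}"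
  have "hausdorff1_pre \<delta> (A \<union> B) \<le> hausdorff1_pre \<delta> A + hausdorff1_pre \<delta> B"
    by (rule hausdorff1_pre_Un_le)
  also have "\<dots> \<le> (SUP \<delta>\<in>{0<..}. hausdorff1_pre \<delta> A) + (SUP \<delta>\<in>{0<..}. hausdorff1_pre \<delta> B)"
    by (intro add_mono SUP_upper \<delta>)
  finally show "hausdorff1_pre \<delta> (A \<union> B) \<le> \<dots>" .
qed

text \<open>
  Cut the parameter interval into \<open>N\<close> equal pieces. Their images have diameter at most
  \<open>c (b - a) / N\<close>, which is below any \<open>\<delta>\<close> for large \<open>N\<close>, and the diameters add up to \<open>c (b - a)\<close>.
  The parameter set \<open>T\<close> may have gaps, which allows \<open>\<phi>\<close> to be the inverse of a projection whose
  image is not known to be an interval.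
\<close>

lemma hausdorff1_lipschitz_image:
  fixes \<phi> :: "real \<Rightarrow> 'a::metric_space"
  assumes T: "T \<subseteq> {a..b}" and "a \<le> b" and lam: "0 \<le> c"
    and lip: "\<And>s t. s \<in> T \<Longrightarrow> t \<in> T \<Longrightarrow> dist (\<phi> s) (\<phi> t) \<le> c * \<bar>s - t\<bar>"
  shows "hausdorff1 (\<phi> ` T) \<le> ennreal (c * (b - a))"
  unfolding hausdorff1_def
proof (rule SUP_least)
  fix \<delta> :: real assume "\<delta> \<in> {0<..}"
  then have "\<delta> > 0" by simp
  then obtain N :: nat where N: "c * (b - a) / \<delta> < real N"
    using reals_Archimedean2 by blast
  moreover have "0 \<le> c * (b - a) / \<delta>"
    using assms \<open>\<delta> > 0\<close> by simp
  ultimately have Npos: "real N > 0" by linarith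
  define h where "h = (b - a) / real N"
  have h: "h \<ge> 0" "real N * h = b - a"
    using \<open>a \<le> b\<close> Npos by (auto simp: h_def)
  have hd: "c * h \<le> \<delta>"
    using N Npos \<open>\<delta> > 0\<close> by (simp add: h_def field_simps)
  define U where "U i = (if i < N then \<phi> ` (T \<inter> {a + real i * h..a + (real i + 1) * h}) else {})" for i
  have dU: "dist x y \<le> c * h" if "x \<in> U i" "y \<in> U i" for x y i
  proof -
    have "x \<in> \<phi> ` (T \<inter> {a + real i * h..a + (real i + 1) * h})"
      "y \<in> \<phi> ` (T \<inter> {a + real i * h..a + (real i + 1) * h})"
      using that by (auto simp: U_def split: if_splits)
    then obtain s t where st: "x = \<phi> s" "y = \<phi> t" "s \<in> T" "t \<in> T"
      "s \<in> {a + real i * h..a + (real i + 1) * h}" "t \<in> {a + real i * h..a + (real i + 1) * h}"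
      by blast
    then have "\<bar>s - t\<bar> \<le> h" by (auto simp: algebra_simps abs_le_iff)
    then show ?thesis
      using lip[OF st(3,4)] st(1,2) lam by (meson mult_left_mono order_trans)
  qed
  have bU: "bounded (U i)" for i
    using dU unfolding bounded_two_points by blast
  have diam: "diameter (U i) \<le> c * h" for i
    using dU[of _ i] h lam by (auto simp: diameter_def intro!: cSUP_least)
  have diam0: "diameter (U i) = 0" if "i \<notin> {..<N}" for i
    using that by (simp add: U_def)
  have "\<phi> ` T \<subseteq> (\<Union>i. U i)"
  proof safe
    fix t assume t: "t \<in> T"
    show "\<phi> t \<in> (\<Union>i. U i)"
    proof (cases "t = b")
      case True
      have "real (N - 1) * h + h = b - a"
        using h Npos by (auto simp: of_nat_diff algebra_simps)
      then have "t \<in> {a + real (N - 1) * h..a + (real (N - 1) + 1) * h}"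
        using h True by (auto simp: algebra_simps)
      moreover have "N - 1 < N" using Npos by simp
      ultimately show ?thesis
        using t by (auto simp: U_def intro!: exI[of _ "N - 1"])
    next
      case False
      with t T have "a \<le> t" "t < b" by force+
      then have hp: "h > 0" using Npos by (simp add: h_def)
      define i where "i = nat \<lfloor>(t - a) / h\<rfloor>"
      have 0: "0 \<le> (t - a) / h" using \<open>a \<le> t\<close> hp by simp
      then have i: "real i \<le> (t - a) / h" "(t - a) / h < real i + 1"
        unfolding i_def by linarith+
      then have "t \<in> {a + real i * h..a + (real i + 1) * h}"
        using hp by (auto simp: field_simps)
      moreover have "i < N"
      proof -
        have "(t - a) / h < real N"
          using \<open>t < b\<close> h hp by (simp add: field_simps)
        then show ?thesis using i by linarith
      qed
      ultimately show ?thesis using t by (auto simp: U_def)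
    qed
  qed
  then have "hausdorff1_pre \<delta> (\<phi> ` T) \<le> (\<Sum>i. ennreal (diameter (U i)))"
    unfolding hausdorff1_pre_def using bU order_trans[OF diam hd]
    by (intro Inf_lower) blast
  also have "\<dots> = (\<Sum>i<N. ennreal (diameter (U i)))"
    by (rule suminf_finite) (auto simp: diam0)
  also have "\<dots> \<le> (\<Sum>i<N. ennreal (c * h))"
    by (intro sum_mono ennreal_leI diam)
  also have "\<dots> = ennreal (real N * (c * h))"
    using h lam by (simp add: ennreal_mult ennreal_of_nat_eq_real_of_nat)
  also have "real N * (c * h) = c * (b - a)"
    using h(2) by (metis mult.left_commute)
  finally show "hausdorff1_pre \<delta> (\<phi> ` T) \<le> ennreal (c * (b - a))" .
qed

lemma norm_cos_sin_diff_le: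
  "norm ((vector [cos s, sin s] :: real^2) - vector [cos t, sin t]) \<le> \<bar>s - t\<bar>"
proof -
  have "(norm ((vector [cos s, sin s] :: real^2) - vector [cos t, sin t]))\<^sup>2
      = (cos s - cos t)\<^sup>2 + (sin s - sin t)\<^sup>2"
    unfolding power2_norm_eq_inner by (simp add: inner_vec_def sum_2 power2_eq_square)
  also have "\<dots> = (2 * sin ((s - t) / 2))\<^sup>2"
  proof -
    have "cos (s - t) = 1 - 2 * (sin ((s - t) / 2))\<^sup>2"
      using cos_double_sin[of "(s - t) / 2"] by (simp only: mult_2 field_sum_of_halves)
    moreover have "(cos s - cos t)\<^sup>2 + (sin s - sin t)\<^sup>2 = 2 - 2 * cos (s - t)"
      using sin_cos_squared_add[of s] sin_cos_squared_add[of t]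
      by (simp add: cos_diff power2_eq_square algebra_simps)
    ultimately show ?thesis by (simp add: power2_eq_square)
  qed
  also have "\<dots> \<le> \<bar>s - t\<bar>\<^sup>2"
    using abs_sin_x_le_abs_x[of "(s - t) / 2"]
    by (intro power2_le_iff_abs_le[THEN iffD2]) (auto simp: abs_mult)
  finally show ?thesis
    by (rule power2_le_imp_le) simp
qed

text \<open>
  The nearest-point projection onto \<open>K\<close> is 1-Lipschitz and maps the circle onto the frontier of
  \<open>K\<close>: each frontier point is the projection of the point where its outer normal ray meets the circle.
\<close>

lemma hausdorff1_frontier_convex_le:
  fixes K :: "(real^2) set"
  assumes K: "convex K" "closed K" "interior K \<noteq> {}" and sub: "K \<subseteq> cball c \<rho>"
  shows "hausdorff1 (frontier K) \<le> ennreal (2 * pi * \<rho>)"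
proof -
  have Kne: "K \<noteq> {}" using K(3) interior_subset by blast
  have rho: "\<rho> \<ge> 0"
  proof -
    obtain x where "x \<in> K" using Kne by blast
    then have "dist c x \<le> \<rho>" using sub by auto
    then show ?thesis using zero_le_dist order_trans by blast
  qed
  define \<phi> where "\<phi> t = closest_point K (c + \<rho> *\<^sub>R vector [cos t, sin t])" for t
  have "frontier K \<subseteq> \<phi> ` {0..2 * pi}"
  proof
    fix p assume "p \<in> frontier K"
    then have p: "p \<in> K" "p \<in> closure K" "p \<notin> rel_interior K"
      using K by (auto simp: frontier_def rel_interior_nonempty_interior)
    obtain a where a: "a \<noteq> 0" "\<And>y. y \<in> K \<Longrightarrow> a \<bullet> p \<le> a \<bullet> y"
      by (rule supporting_hyperplane_rel_boundary[OF K(1) p(1) p(3)]) blast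
    have "\<exists>t\<ge>0. dist c (p - t *\<^sub>R a) = \<rho>"
    proof -
      \<comment> \<open>Walking the length of the diameter along the normal leads out of the disc.\<close>
      define T where "T = (2 * \<rho>) / norm a"
      have "T \<ge> 0" using rho by (simp add: T_def)
      have "dist c p \<le> \<rho>" using p(1) sub by auto
      moreover have "\<rho> \<le> dist c (p - T *\<^sub>R a)"
      proof -
        have "dist p (p - T *\<^sub>R a) = 2 * \<rho>"
          using a(1) rho by (simp add: dist_norm T_def)
        then show ?thesis
          using \<open>dist c p \<le> \<rho>\<close> dist_triangle[of p "p - T *\<^sub>R a" c] by (simp add: dist_commute)
      qed
      ultimately obtain t where "0 \<le> t" "dist c (p - t *\<^sub>R a) = \<rho>"
        using IVT'[of "\<lambda>t. dist c (p - t *\<^sub>R a)" 0 \<rho> T] \<open>T \<ge> 0\<close>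
        by (force intro!: continuous_intros)
      then show ?thesis by blast
    qed
    then obtain t where t: "t \<ge> 0" "dist c (p - t *\<^sub>R a) = \<rho>" by blast
    define q where "q = p - t *\<^sub>R a"
    have "dist q p \<le> dist q y" if "y \<in> K" for y
    proof -
      have "(q - p) \<bullet> (y - p) \<le> 0"
        using a(2)[OF that] t(1) by (simp add: q_def inner_diff_right mult_left_mono)
      moreover have "(norm ((q - p) - (y - p)))\<^sup>2 = (norm (q - p))\<^sup>2 + (norm (y - p))\<^sup>2 - 2 * ((q - p) \<bullet> (y - p))"
        unfolding power2_norm_eq_inner by (simp only: inner_diff_left[of "q - p"] inner_diff_right[of _ "q - p"] inner_commute[of "y - p" "q - p"])
      ultimately have "(norm (q - p))\<^sup>2 \<le> (norm ((q - p) - (y - p)))\<^sup>2"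
        using zero_le_power2[of "norm (y - p)"] by linarith
      then have "norm (q - p) \<le> norm ((q - p) - (y - p))"
        by (rule power2_le_imp_le) simp
      then show ?thesis
        by (simp add: dist_norm)
    qed
    then have "p = closest_point K q"
      using K p by (intro closest_point_unique) auto
    moreover have "\<exists>s\<in>{0..2 * pi}. q = c + \<rho> *\<^sub>R vector [cos s, sin s]"
    proof (cases "\<rho> = 0")
      case True
      then show ?thesis using t(2) by (auto simp: q_def intro!: bexI[of _ 0])
    next
      case False
      define d where "d = (1 / \<rho>) *\<^sub>R (q - c)"
      have "norm d = 1"
        using t(2) False rho by (simp add: d_def q_def dist_norm norm_minus_commute)
      then have "(d$1)\<^sup>2 + (d$2)\<^sup>2 = 1"
        by (simp add: norm_eq_sqrt_inner inner_vec_def sum_2 power2_eq_square)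
      then obtain s where s: "0 \<le> s" "s < 2 * pi" "d$1 = cos s" "d$2 = sin s"
        by (rule sincos_total_2pi)
      then have "d = vector [cos s, sin s]"
        by (simp add: vec_eq_iff forall_2)
      moreover have "q = c + \<rho> *\<^sub>R d"
        using False by (simp add: d_def)
      ultimately have "q = c + \<rho> *\<^sub>R vector [cos s, sin s]"
        by simp
      then show ?thesis using s by auto
    qed
    ultimately show "p \<in> \<phi> ` {0..2 * pi}"
      by (auto simp: \<phi>_def)
  qed
  then have "hausdorff1 (frontier K) \<le> hausdorff1 (\<phi> ` {0..2 * pi})"
    by (rule hausdorff1_mono)
  also have "\<dots> \<le> ennreal (\<rho> * (2 * pi - 0))"
  proof (rule hausdorff1_lipschitz_image)
    fix s t
    have "dist (\<phi> s) (\<phi> t) \<le> norm (\<rho> *\<^sub>R (vector [cos s, sin s] - vector [cos t, sin t] :: real^2))"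
      unfolding \<phi>_def using closest_point_lipschitz[OF K(1,2) Kne]
      by (metis (no_types, lifting) add_diff_cancel_left dist_norm scaleR_diff_right)
    also have "\<dots> \<le> \<rho> * \<bar>s - t\<bar>"
      using norm_cos_sin_diff_le[of s t] rho by (simp add: mult_left_mono)
    finally show "dist (\<phi> s) (\<phi> t) \<le> \<rho> * \<bar>s - t\<bar>" .
  qed (use rho in auto)
  finally show ?thesis by (simp add: mult.commute)
qed

lemma hausdorff1_empty [simp]: "hausdorff1 {} = 0"
proof -
  have "hausdorff1 ((\<lambda>_. undefined) ` ({} :: real set)) \<le> ennreal (0 * (0 - 0))"
    by (rule hausdorff1_lipschitz_image) auto
  then show ?thesis by simp
qed

lemma hausdorff1_UN_le:
  assumes "finite I"
  shows "hausdorff1 (\<Union>i\<in>I. A i) \<le> (\<Sum>i\<in>I. hausdorff1 (A i))"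
  using assms
proof (induction I)
  case (insert i I)
  have "hausdorff1 (\<Union>i\<in>insert i I. A i) \<le> hausdorff1 (A i) + hausdorff1 (\<Union>i\<in>I. A i)"
    using hausdorff1_Un_le[of "A i" "\<Union>i\<in>I. A i"] by simp
  also have "\<dots> \<le> (\<Sum>i\<in>insert i I. hausdorff1 (A i))"
    using insert by (simp add: add_left_mono)
  finally show ?case .
qed simp

section \<open>Perimeter of a plane convex set containing a segment\<close>

lemma convex_combination_closure_in:
  fixes C :: "'a::euclidean_space set"
  assumes "convex C" "open C" "a \<in> C" "b \<in> closure C" "0 \<le> t" "t < 1"
  shows "(1 - t) *\<^sub>R a + t *\<^sub>R b \<in> C"
proof (cases "t = 0 \<or> a = b")
  case True
  then show ?thesis using assms by (auto simp: algebra_simps)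
next
  case False
  then have "(1 - t) *\<^sub>R a + t *\<^sub>R b \<in> open_segment a b"
    using assms by (auto simp: in_segment intro!: exI[of _ t])
  then show ?thesis
    using in_interior_closure_convex_segment[of C a b] assms by (auto simp: interior_open)
qed

text \<open>
  If the convex set has height \<open>s\<close> over the point at distance \<open>x\<close> from \<open>v\<close>, then it contains all points
  of the grid of mesh \<open>sqrt x\<close> on that vertical up to height \<open>s\<close>. The first \<open>J\<close> odd numbers sum to
  \<open>J\<^sup>2\<close>, so this sum dominates \<open>s\<^sup>2 / x\<close>. A random cell has height of order at most \<open>sqrt x\<close> there, so with
  this mesh the sum has an expectation bounded uniformly in \<open>x\<close>.
\<close>

definition section_bound :: "(real^2) set \<Rightarrow> real^2 \<Rightarrow> real^2 \<Rightarrow> real^2 \<Rightarrow> real \<Rightarrow> ennreal" where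
  "section_bound C v e u x =
     (\<Sum>j. ennreal (2 * real j + 1) * of_bool (v + x *\<^sub>R e + (real j * sqrt x) *\<^sub>R u \<in> C))"

text \<open>
  Up to the additive constant 2, this dominates the least radius \<open>\<rho> = k + 2\<close> for which the set misses
  all the balls centred at \<open>v + \<rho> d\<close> with radius \<open>\<rho> / 128\<close>. The net \<open>F\<close> of directions has mesh
  \<open>1 / 128\<close>, and only directions that do not point towards the second point are used.
\<close>

definition cap_bound :: "(real^2) set \<Rightarrow> (real^2) set \<Rightarrow> real^2 \<Rightarrow> real^2 \<Rightarrow> ennreal" where
  "cap_bound F C v e = (\<Sum>k. \<Sum>d\<in>{d\<in>F. d \<bullet> e \<le> 3 / 4}.
     of_bool (C \<inter> cball (v + (real k + 2) *\<^sub>R d) ((real k + 2) / 128) \<noteq> {}))"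

text \<open>
  An open convex set containing two points at distance \<open>m\<close>, with an orthonormal frame whose first
  vector \<open>e\<close> points from \<open>v\<close> to the other point. Exchanging the two points and reversing \<open>u\<close>
  give further instances, so it suffices to bound slopes from one end and arcs on one side.
\<close>

locale cell_frame =
  fixes C :: "(real^2) set" and v e u :: "real^2" and m :: real
  assumes open_C: "open C" and convex_C: "convex C"
    and v_in: "v \<in> C" and w_in: "v + m *\<^sub>R e \<in> C"
    and norm_e: "norm e = 1" and norm_u: "norm u = 1" and orth: "e \<bullet> u = 0" and m_pos: "m > 0"
begin

definition pt :: "real \<Rightarrow> real \<Rightarrow> real^2" where
  "pt x y = v + x *\<^sub>R e + y *\<^sub>R u"

lemma swap: "cell_frame C (v + m *\<^sub>R e) (- e) u m"
  using open_C convex_C v_in w_in norm_e norm_u orth m_pos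
  by unfold_locales (auto simp: inner_minus_left)

lemma swap_pt: "cell_frame.pt (v + m *\<^sub>R e) (- e) u x y = pt (m - x) y"
  by (simp add: cell_frame.pt_def[OF swap] pt_def algebra_simps)

lemma flip: "cell_frame C v e (- u) m"
  using open_C convex_C v_in w_in norm_e norm_u orth m_pos
  by unfold_locales auto

lemma ee: "e \<bullet> e = 1" "u \<bullet> u = 1" "u \<bullet> e = 0"
  using norm_e norm_u orth by (simp_all add: norm_eq_1 inner_commute)

lemma pt_coords [simp]: "(pt x y - v) \<bullet> e = x" "(pt x y - v) \<bullet> u = y"
  by (simp_all add: pt_def inner_add_left ee orth)

lemma pt_expand: "z = pt ((z - v) \<bullet> e) ((z - v) \<bullet> u)"
proof -
  define d where "d = z - pt ((z - v) \<bullet> e) ((z - v) \<bullet> u)"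
  have "d \<bullet> e = 0" "d \<bullet> u = 0"
    unfolding d_def pt_def by (simp_all add: inner_diff_left inner_add_left ee orth)
  then have d: "d$1 * e$1 + d$2 * e$2 = 0" "d$1 * u$1 + d$2 * u$2 = 0"
    by (simp_all add: inner_vec_def sum_2)
  have eu: "e$1 * e$1 + e$2 * e$2 = 1" "u$1 * u$1 + u$2 * u$2 = 1" "e$1 * u$1 + e$2 * u$2 = 0"
    using ee orth by (simp_all add: inner_vec_def sum_2)
  \<comment> \<open>The determinant of the frame.\<close>
  define D where "D = e$1 * u$2 - e$2 * u$1"
  have "D * D = (e$1 * e$1 + e$2 * e$2) * (u$1 * u$1 + u$2 * u$2) - (e$1 * u$1 + e$2 * u$2) * (e$1 * u$1 + e$2 * u$2)"
    by (simp add: D_def algebra_simps)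
  then have "D \<noteq> 0" unfolding eu by auto
  have "d$1 * D = (d$1 * e$1 + d$2 * e$2) * u$2 - (d$1 * u$1 + d$2 * u$2) * e$2"
    "d$2 * D = (d$1 * u$1 + d$2 * u$2) * e$1 - (d$1 * e$1 + d$2 * e$2) * u$1"
    by (simp_all add: D_def algebra_simps)
  then have "d$1 * D = 0" "d$2 * D = 0" unfolding d by simp_all
  then have "d = 0" using \<open>D \<noteq> 0\<close> by (simp add: vec_eq_iff forall_2)
  then show ?thesis by (simp add: d_def)
qed

lemma dist_pt: "dist (pt a f) (pt b g) = sqrt ((a - b)\<^sup>2 + (f - g)\<^sup>2)"
proof -
  have "pt a f - pt b g = (a - b) *\<^sub>R e + (f - g) *\<^sub>R u"
    by (simp add: pt_def algebra_simps)
  then show ?thesis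
    by (simp add: dist_norm norm_eq_sqrt_inner inner_add_left inner_add_right ee orth power2_eq_square)
qed

lemma pt_combination: "(1 - t) *\<^sub>R pt a f + t *\<^sub>R pt b g = pt ((1 - t) * a + t * b) ((1 - t) * f + t * g)"
  by (simp add: pt_def algebra_simps)

lemma pt_axis: "0 \<le> a \<Longrightarrow> a \<le> m \<Longrightarrow> pt a 0 \<in> C"
proof -
  assume a: "0 \<le> a" "a \<le> m"
  have "pt a 0 = (1 - a / m) *\<^sub>R v + (a / m) *\<^sub>R (v + m *\<^sub>R e)"
    using m_pos by (simp add: pt_def algebra_simps)
  also have "\<dots> \<in> C"
    using convex_C v_in w_in a m_pos by (intro convexD_alt) auto
  finally show ?thesis .
qed

lemma pt_below:
  assumes "pt a f \<in> closure C" "0 \<le> a" "a \<le> m" "0 \<le> s" "s < f"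
  shows "pt a s \<in> C"
proof -
  have "pt a s = (1 - s / f) *\<^sub>R pt a 0 + (s / f) *\<^sub>R pt a f"
    unfolding pt_combination using assms by (simp add: algebra_simps)
  also have "\<dots> \<in> C"
    using convex_C open_C pt_axis assms by (intro convex_combination_closure_in) auto
  finally show ?thesis .
qed

lemma frontier_notin: "z \<in> frontier C \<Longrightarrow> z \<notin> C" "z \<in> frontier C \<Longrightarrow> z \<in> closure C"
  using open_C by (auto simp: frontier_def interior_open)

lemma section_bound_ge:
  assumes x: "0 < x" "x \<le> m" and s: "0 \<le> s" and C: "pt x s \<in> C"
  shows "ennreal (s\<^sup>2 / x) \<le> section_bound C v e u x"
proof -
  define J where "J = nat \<lfloor>s / sqrt x\<rfloor>"
  have J: "real J \<le> s / sqrt x" "s / sqrt x \<le> real J + 1"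
    using x s unfolding J_def by (simp_all add: of_nat_floor)
  have inC: "v + x *\<^sub>R e + (real j * sqrt x) *\<^sub>R u \<in> C" if "j < Suc J" for j
  proof -
    have "real j \<le> s / sqrt x" using that J by linarith
    then have "real j * sqrt x \<le> s" using x by (simp add: field_simps)
    then consider "real j * sqrt x < s" | "real j * sqrt x = s" by linarith
    then have "pt x (real j * sqrt x) \<in> C"
    proof cases
      case 1
      then show ?thesis using C x by (intro pt_below[of x s]) (auto intro: subsetD[OF closure_subset])
    next
      case 2
      show ?thesis unfolding 2 by (rule C)
    qed
    then show ?thesis by (simp add: pt_def)
  qed
  have odd: "(\<Sum>j<k. 2 * real j + 1) = (real k)\<^sup>2" for k
    by (induction k) (simp_all add: power2_eq_square algebra_simps)
  have "s\<^sup>2 / x = (s / sqrt x)\<^sup>2"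
    using x by (simp add: power_divide)
  also have "\<dots> \<le> (real (Suc J))\<^sup>2"
    using J x s by (intro power_mono) auto
  finally have "ennreal (s\<^sup>2 / x) \<le> ennreal (\<Sum>j<Suc J. 2 * real j + 1)"
    unfolding odd by (rule ennreal_leI)
  also have "\<dots> = (\<Sum>j<Suc J. ennreal (2 * real j + 1) * of_bool (v + x *\<^sub>R e + (real j * sqrt x) *\<^sub>R u \<in> C))"
    using inC by (subst sum_ennreal[symmetric]) (auto intro!: sum.cong simp del: sum.lessThan_Suc)
  also have "\<dots> \<le> section_bound C v e u x"
    unfolding section_bound_def by (intro sum_le_suminf) auto
  finally show ?thesis .
qed

text \<open>
  As the set is star-shaped about \<open>v\<close>, height divided by distance from \<open>v\<close> decreases along the
  frontier. Hence \<open>g / b \<le> f / a\<close>, which bounds the slope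
  between the two points by \<open>f / a\<close>, and this in turn is at most the ratio at \<open>x\<close>.
\<close>

lemma frontier_slope_le:
  assumes fr: "pt a f \<in> frontier C" "pt b g \<in> frontier C" and fg: "0 \<le> f" "0 \<le> g"
    and x: "0 < x" "x \<le> a" "a < b" "b \<le> m"
    and bound: "\<And>s. 0 \<le> s \<Longrightarrow> pt x s \<in> C \<Longrightarrow> s \<le> k * x"
  shows "g - f \<le> k * (b - a)"
proof -
  \<comment> \<open>The point over \<open>x\<close> on the segment from \<open>v\<close> to the frontier point at \<open>a\<close> has height \<open>f x / a\<close>.
  It lies in the closure only; all smaller heights belong to the set itself.\<close>
  have f: "f * x / a \<le> k * x"
  proof (rule dense_le_bounded[of 0])
    show "0 < f * x / a"
    proof -
      have "f \<noteq> 0" using pt_axis[of a] frontier_notin(1)[OF fr(1)] x by auto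
      then show ?thesis using fg x by simp
    qed
    fix s assume s: "0 < s" "s < f * x / a"
    have "pt x (f * x / a) = (1 - x / a) *\<^sub>R pt 0 0 + (x / a) *\<^sub>R pt a f"
      unfolding pt_combination using x by (simp add: mult.commute)
    also have "\<dots> \<in> closure C"
      using convex_closure[OF convex_C] frontier_notin(2)[OF fr(1)] v_in x closure_subset
      by (intro convexD_alt) (auto simp: pt_def)
    finally have "pt x s \<in> C" using s x by (intro pt_below) auto
    then show "s \<le> k * x" using s bound by auto
  qed
  \<comment> \<open>Otherwise the frontier point at \<open>a\<close> would lie strictly below the segment from \<open>v\<close> to the one at \<open>b\<close>.\<close>
  have "\<not> f < g * a / b"
  proof
    assume lt: "f < g * a / b"
    have "pt a (g * a / b) = (1 - a / b) *\<^sub>R pt 0 0 + (a / b) *\<^sub>R pt b g"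
      unfolding pt_combination using x by (simp add: mult.commute)
    also have "\<dots> \<in> C"
      using convex_C open_C frontier_notin(2)[OF fr(2)] v_in x
      by (intro convex_combination_closure_in) (auto simp: pt_def)
    finally have "pt a f \<in> C"
      using lt fg x closure_subset by (intro pt_below[of a "g * a / b"]) auto
    then show False using frontier_notin(1)[OF fr(1)] by simp
  qed
  then have "g \<le> f * b / a" using x by (simp add: field_simps)
  then have "g - f \<le> (f / a) * (b - a)" using x by (simp add: field_simps)
  also have "\<dots> \<le> k * (b - a)"
  proof (rule mult_right_mono)
    have "(f / a) * x \<le> k * x" using f by simp
    then show "f / a \<le> k" by (rule mult_right_le_imp_le) (use x in simp)
  qed (use x in simp)
  finally show ?thesis .
qed

lemma frontier_height_unique:
  assumes "pt a f \<in> frontier C" "pt a g \<in> frontier C" "0 \<le> f" "0 \<le> g" "0 \<le> a" "a \<le> m"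
  shows "f = g"
  using assms pt_below[of a f g] pt_below[of a g f] frontier_notin by (metis linorder_neqE_linordered_idom)

end

definition arc_bound ::
  "(real^2) set \<Rightarrow> real^2 \<Rightarrow> real^2 \<Rightarrow> real^2 \<Rightarrow> real \<Rightarrow> real \<Rightarrow> real \<Rightarrow> ennreal" where
  "arc_bound C v e u m x x' = ennreal (x' - x) + ennreal ((x' - x) / 2) *
     (section_bound C v e u x * ennreal (1 / x)
      + section_bound C (v + m *\<^sub>R e) (- e) u (m - x') * ennreal (1 / (m - x')))"

text \<open>
  The slope bounds from \<open>v\<close> and from \<open>w\<close> make the arc a Lipschitz graph over \<open>[x, x']\<close>, with squared
  slope at most the sum of the two terms in \<open>arc_bound\<close>; then \<open>sqrt (1 + q) \<le> 1 + q / 2\<close>.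
\<close>

lemma (in cell_frame) hausdorff1_arc_le:
  assumes x: "0 < x" "x < x'" "x' < m"
  shows "hausdorff1 (frontier C \<inter> {z. x \<le> (z - v) \<bullet> e \<and> (z - v) \<bullet> e \<le> x' \<and> 0 \<le> (z - v) \<bullet> u})
    \<le> arc_bound C v e u m x x'"
    (is "hausdorff1 ?A \<le> _")
proof -
  let ?S1 = "section_bound C v e u x" and ?S2 = "section_bound C (v + m *\<^sub>R e) (- e) u (m - x')"
  have "hausdorff1 ?A \<le> ennreal (x' - x) + ennreal ((x' - x) / 2) *
    (?S1 * ennreal (1 / x) + ?S2 * ennreal (1 / (m - x')))"
  proof (cases "?S1 = top \<or> ?S2 = top")
    case True
    then have "ennreal ((x' - x) / 2) * (?S1 * ennreal (1 / x) + ?S2 * ennreal (1 / (m - x'))) = top"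
      using x by (auto simp: ennreal_mult_eq_top_iff ennreal_eq_0_iff)
    then show ?thesis by simp
  next
    case False
    then obtain s1 s2 where s: "?S1 = ennreal s1" "?S2 = ennreal s2" "0 \<le> s1" "0 \<le> s2"
      by (metis ennreal_cases)
    define k1 k2 where "k1 = sqrt (s1 / x)" and "k2 = sqrt (s2 / (m - x'))"
    have k: "0 \<le> k1" "0 \<le> k2" "k1\<^sup>2 = s1 / x" "k2\<^sup>2 = s2 / (m - x')"
      using x s by (auto simp: k1_def k2_def)
    interpret sw: cell_frame C "v + m *\<^sub>R e" "- e" u m by (rule swap)
    have b1: "y \<le> k1 * x" if "0 \<le> y" "pt x y \<in> C" for y
    proof -
      have "y\<^sup>2 / x \<le> s1"
        using section_bound_ge[OF _ _ that] x s by simp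
      then have "y\<^sup>2 \<le> s1 * x"
        using x by (simp add: pos_divide_le_eq)
      also have "\<dots> = (k1 * x)\<^sup>2"
        unfolding power_mult_distrib k using x by (simp add: power2_eq_square)
      finally have "y\<^sup>2 \<le> (k1 * x)\<^sup>2" .
      then show ?thesis by (rule power2_le_imp_le) (use k(1,2) x in simp)
    qed
    have b2: "y \<le> k2 * (m - x')" if "0 \<le> y" "sw.pt (m - x') y \<in> C" for y
    proof -
      have "y\<^sup>2 / (m - x') \<le> s2"
        using sw.section_bound_ge[OF _ _ that] x s by simp
      then have "y\<^sup>2 \<le> s2 * (m - x')"
        using x by (simp add: pos_divide_le_eq)
      also have "\<dots> = (k2 * (m - x'))\<^sup>2"
        unfolding power_mult_distrib k using x by (simp add: power2_eq_square)
      finally have "y\<^sup>2 \<le> (k2 * (m - x'))\<^sup>2" .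
      then show ?thesis by (rule power2_le_imp_le) (use k(1,2) x in simp)
    qed
    have gen: "ennreal (a + b * (p * c + q * d)) = ennreal a + ennreal b * (ennreal p * ennreal c + ennreal q * ennreal d)"
      if "0 \<le> a" "0 \<le> b" "0 \<le> p" "0 \<le> c" "0 \<le> q" "0 \<le> d" for a b p c q d :: real
      using that by (simp add: ennreal_mult)
    have alg: "(1 + q / 2) * d = d + d / 2 * q" for q d :: real
      by (simp add: algebra_simps)
    define L where "L = sqrt (1 + (k1\<^sup>2 + k2\<^sup>2))"
    have L0: "0 \<le> L" by (simp add: L_def)
    have lip: "dist (pt a f) (pt b g) \<le> L * (b - a)"
      if "pt a f \<in> ?A" "pt b g \<in> ?A" "a \<le> b" for a b f g
    proof (cases "a = b")
      case True
      then show ?thesis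
        using frontier_height_unique[of a f g] that x by auto
    next
      case False
      have h: "pt a f \<in> frontier C" "pt b g \<in> frontier C" "0 \<le> f" "0 \<le> g" "x \<le> a" "b \<le> x'" "a < b"
        using that False by auto
      have "g - f \<le> k1 * (b - a)"
        using h x b1 by (intro frontier_slope_le) auto
      moreover have "f - g \<le> k2 * ((m - a) - (m - b))"
        using h x b2 by (intro sw.frontier_slope_le[of _ _ _ _ "m - x'"]) (auto simp: swap_pt)
      ultimately have "(f - g)\<^sup>2 \<le> (max k1 k2 * (b - a))\<^sup>2"
        using h by (intro abs_le_square_iff[THEN iffD1])
          (smt (verit, best) max.cobounded1 max.cobounded2 mult_right_mono)
      also have "\<dots> = (max k1 k2)\<^sup>2 * (b - a)\<^sup>2" by (simp add: power_mult_distrib)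
      also have "\<dots> \<le> (k1\<^sup>2 + k2\<^sup>2) * (b - a)\<^sup>2"
        by (intro mult_right_mono) (auto simp: max_def)
      finally have "(a - b)\<^sup>2 + (f - g)\<^sup>2 \<le> (1 + (k1\<^sup>2 + k2\<^sup>2)) * (b - a)\<^sup>2"
        by (simp add: algebra_simps power2_commute)
      then have "sqrt ((a - b)\<^sup>2 + (f - g)\<^sup>2) \<le> sqrt ((1 + (k1\<^sup>2 + k2\<^sup>2)) * (b - a)\<^sup>2)"
        by (rule real_sqrt_le_mono)
      then show ?thesis
        using h by (simp add: dist_pt real_sqrt_mult L_def)
    qed
    \<comment> \<open>The arc is the image of its projection under the inverse of the projection.\<close>
    define T where "T = (\<lambda>z. (z - v) \<bullet> e) ` ?A"
    define \<phi> where "\<phi> t = pt t (SOME y. pt t y \<in> ?A)" for t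
    have \<phi>: "\<phi> t \<in> ?A" if tT: "t \<in> T" for t
    proof -
      obtain z where "z \<in> ?A" "t = (z - v) \<bullet> e" using tT unfolding T_def by blast
      then have "pt t ((z - v) \<bullet> u) \<in> ?A" using pt_expand[of z] by simp
      then show ?thesis unfolding \<phi>_def by (rule someI)
    qed
    have \<phi>_lip: "dist (\<phi> s) (\<phi> t) \<le> L * \<bar>s - t\<bar>" if "s \<in> T" "t \<in> T" for s t
    proof (cases "s \<le> t")
      case True
      then show ?thesis
        using lip[OF \<phi>[OF that(1), unfolded \<phi>_def] \<phi>[OF that(2), unfolded \<phi>_def]] by (simp add: \<phi>_def)
    next
      case False
      then show ?thesis
        using lip[OF \<phi>[OF that(2), unfolded \<phi>_def] \<phi>[OF that(1), unfolded \<phi>_def]]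
        by (simp add: \<phi>_def dist_commute)
    qed
    have "?A \<subseteq> \<phi> ` T"
    proof
      fix z assume z: "z \<in> ?A"
      define t where "t = (z - v) \<bullet> e"
      have t: "t \<in> T" using z by (auto simp: T_def t_def)
      have "pt t ((z - v) \<bullet> u) \<in> ?A" using z pt_expand[of z] by (simp add: t_def)
      then have "dist (pt t ((z - v) \<bullet> u)) (\<phi> t) \<le> L * (t - t)"
        using lip \<phi>[OF t] unfolding \<phi>_def by blast
      then have "z = \<phi> t" using pt_expand[of z] by (simp add: t_def)
      then show "z \<in> \<phi> ` T" using t by blast
    qed
    then have "hausdorff1 ?A \<le> hausdorff1 (\<phi> ` T)" by (rule hausdorff1_mono)
    also have "\<dots> \<le> ennreal (L * (x' - x))"
      by (rule hausdorff1_lipschitz_image) (use x L0 \<phi>_lip in \<open>auto simp: T_def\<close>)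
    also have "\<dots> \<le> ennreal ((1 + (k1\<^sup>2 + k2\<^sup>2) / 2) * (x' - x))"
    proof (intro ennreal_leI mult_right_mono)
      have sq: "1 + q \<le> (1 + q / 2)\<^sup>2" for q :: real
        using zero_le_power2[of q] by (simp add: power2_eq_square algebra_simps)
      have "L \<le> sqrt ((1 + (k1\<^sup>2 + k2\<^sup>2) / 2)\<^sup>2)"
        unfolding L_def by (intro real_sqrt_le_mono sq)
      then show "L \<le> 1 + (k1\<^sup>2 + k2\<^sup>2) / 2" by simp
    qed (use x in simp)
    also have "(1 + (k1\<^sup>2 + k2\<^sup>2) / 2) * (x' - x)
      = (x' - x) + (x' - x) / 2 * (s1 * (1 / x) + s2 * (1 / (m - x')))"
      unfolding k alg by simp
    also have "ennreal \<dots> = ennreal (x' - x) + ennreal ((x' - x) / 2) * (?S1 * ennreal (1 / x) + ?S2 * ennreal (1 / (m - x')))"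
      unfolding s using x s(3,4) gen[of "x' - x" "(x' - x) / 2" s1 "1 / x" s2 "1 / (m - x')"] by simp
    finally show ?thesis .
  qed
  then show ?thesis by (simp only: arc_bound_def)
qed

context cell_frame
begin

text \<open>
  If the cap left the disc of radius \<open>r\<close>, then by convexity it would meet the circle of radius \<open>r\<close> in
  a point whose direction makes an inner product at most \<open>1 / r \<le> 1 / 2\<close> with \<open>e\<close>. That point lies in
  one of the balls that the set misses.
\<close>

lemma hausdorff1_cap_le_radius:
  assumes net: "\<And>d. norm d = 1 \<Longrightarrow> \<exists>f\<in>F. dist d f \<le> 1 / 128" and r: "2 \<le> r"
    and miss: "\<And>d. d \<in> F \<Longrightarrow> d \<bullet> e \<le> 3 / 4 \<Longrightarrow> C \<inter> cball (v + r *\<^sub>R d) (r / 128) = {}"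
  shows "hausdorff1 (frontier C \<inter> {z. (z - v) \<bullet> e \<le> 1}) \<le> ennreal (2 * pi * r)"
proof -
  define K where "K = closure C \<inter> {z. (z - v) \<bullet> e \<le> 1}"
  have half: "{z. (z - v) \<bullet> e \<le> 1} = {z. e \<bullet> z \<le> 1 + e \<bullet> v}"
    by (auto simp: inner_diff_right inner_commute[of _ e])
  have K: "convex K" "closed K"
    unfolding K_def half
    by (auto intro!: convex_Int convex_closure convex_C convex_halfspace_le closed_Int closed_halfspace_le)
  have "C \<inter> {z. e \<bullet> z < 1 + e \<bullet> v} \<subseteq> interior K"
    unfolding K_def half
    by (rule interior_maximal)
       (use closure_subset[of C] in \<open>auto intro!: open_Int open_C open_halfspace_lt\<close>)
  then have int: "interior K \<noteq> {}" using v_in by auto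
  have "K \<subseteq> cball v r"
  proof
    fix z assume z: "z \<in> K"
    show "z \<in> cball v r"
    proof (rule ccontr)
      assume "z \<notin> cball v r"
      then have far: "r < norm (z - v)" by (simp add: dist_norm norm_minus_commute)
      define t where "t = r / norm (z - v)"
      have t: "0 < t" "t < 1" using far r by (auto simp: t_def divide_simps)
      define y where "y = (1 - t) *\<^sub>R v + t *\<^sub>R z"
      have "y \<in> C"
        unfolding y_def using z t v_in
        by (intro convex_combination_closure_in convex_C open_C) (auto simp: K_def)
      define d where "d = (1 / r) *\<^sub>R (y - v)"
      have yv: "y - v = t *\<^sub>R (z - v)" by (simp add: y_def algebra_simps)
      have y: "y = v + r *\<^sub>R d" using r by (simp add: d_def)
      have "norm (y - v) = r"
        unfolding yv using far r by (auto simp: t_def)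
      then have "norm d = 1" using r by (simp add: d_def)
      then obtain f where f: "f \<in> F" "dist d f \<le> 1 / 128" using net by blast
      have "t * ((z - v) \<bullet> e) \<le> 1"
      proof -
        have "t * ((z - v) \<bullet> e) \<le> t * 1" using z t by (intro mult_left_mono) (auto simp: K_def)
        then show ?thesis using t(2) by linarith
      qed
      then have "d \<bullet> e \<le> 1 / r"
        using r by (simp add: d_def yv divide_right_mono)
      also have "\<dots> \<le> 1 / 2" using r by (simp add: divide_simps)
      finally have "d \<bullet> e \<le> 1 / 2" .
      moreover have "(f - d) \<bullet> e \<le> norm (f - d)"
        using norm_cauchy_schwarz[of "f - d" e] by (simp add: norm_e)
      ultimately have "f \<bullet> e \<le> 3 / 4"
        using f(2) by (simp add: inner_diff_left dist_norm norm_minus_commute)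
      moreover have "dist (v + r *\<^sub>R f) y \<le> r / 128"
      proof -
        have "dist (v + r *\<^sub>R f) y = r * dist d f"
          unfolding y using r by (simp add: dist_norm norm_minus_commute flip: scaleR_diff_right)
        also have "\<dots> \<le> r * (1 / 128)" using f r by (intro mult_left_mono) auto
        finally show ?thesis by simp
      qed
      ultimately show False using miss[OF f(1)] \<open>y \<in> C\<close> by auto
    qed
  qed
  then have "hausdorff1 (frontier K) \<le> ennreal (2 * pi * r)"
    by (rule hausdorff1_frontier_convex_le[OF K int])
  moreover have "frontier C \<inter> {z. (z - v) \<bullet> e \<le> 1} \<subseteq> frontier K"
  proof -
    have "interior K \<subseteq> interior (closure C)"
      by (rule interior_mono) (auto simp: K_def)
    also have "\<dots> = C"
      using convex_C open_C by (simp add: convex_interior_closure interior_open)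
    finally have "interior K \<subseteq> C" .
    then show ?thesis
      using open_C K(2) by (auto simp: frontier_def interior_open K_def)
  qed
  ultimately show ?thesis using hausdorff1_mono order_trans by blast
qed

lemma hausdorff1_cap_le:
  assumes F: "finite F" and net: "\<And>d. norm d = 1 \<Longrightarrow> \<exists>f\<in>F. dist d f \<le> 1 / 128"
  shows "hausdorff1 (frontier C \<inter> {z. (z - v) \<bullet> e \<le> 1}) \<le> ennreal (2 * pi) * (2 + cap_bound F C v e)"
    (is "hausdorff1 ?A \<le> _")
proof -
  define row :: "nat \<Rightarrow> ennreal" where "row k = (\<Sum>d\<in>{d\<in>F. d \<bullet> e \<le> 3 / 4}.
     of_bool (C \<inter> cball (v + (real k + 2) *\<^sub>R d) ((real k + 2) / 128) \<noteq> {}))" for k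
  have cap: "cap_bound F C v e = (\<Sum>k. row k)"
    by (simp add: cap_bound_def row_def)
  have ge1: "1 \<le> row k" if nz: "row k \<noteq> 0" for k
  proof -
    obtain d where d: "d \<in> {d\<in>F. d \<bullet> e \<le> 3 / 4}"
      "of_bool (C \<inter> cball (v + (real k + 2) *\<^sub>R d) ((real k + 2) / 128) \<noteq> {}) \<noteq> (0 :: ennreal)"
      using nz[unfolded row_def] by (rule sum.not_neutral_contains_not_neutral)
    have "of_bool (C \<inter> cball (v + (real k + 2) *\<^sub>R d) ((real k + 2) / 128) \<noteq> {}) \<le> row k"
      unfolding row_def using F d(1) by (intro member_le_sum) auto
    then show ?thesis using d(2) by simp
  qed
  have n_le: "of_nat n \<le> cap_bound F C v e" if "\<And>k. k < n \<Longrightarrow> row k \<noteq> 0" for n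
  proof -
    have "of_nat n = (\<Sum>k<n. 1 :: ennreal)" by simp
    also have "\<dots> \<le> (\<Sum>k<n. row k)" using that ge1 by (intro sum_mono) auto
    also have "\<dots> \<le> cap_bound F C v e" unfolding cap by (intro sum_le_suminf) auto
    finally show ?thesis .
  qed
  show ?thesis
  proof (cases "\<exists>k. row k = 0")
    case False
    then have "of_nat n \<le> cap_bound F C v e" for n using n_le by blast
    then have "cap_bound F C v e = top"
      by (metis ennreal_Ex_less_of_nat linorder_not_le top.not_eq_extremum)
    then show ?thesis by (simp add: ennreal_mult_eq_top_iff)
  next
    case True
    define k where "k = (LEAST k. row k = 0)"
    have "row k = 0" using True unfolding k_def by (rule LeastI_ex)
    then have "C \<inter> cball (v + (real k + 2) *\<^sub>R d) ((real k + 2) / 128) = {}" if "d \<in> F" "d \<bullet> e \<le> 3 / 4" for d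
      using that F unfolding row_def by (auto simp: sum_eq_0_iff)
    then have "hausdorff1 ?A \<le> ennreal (2 * pi * (real k + 2))"
      by (intro hausdorff1_cap_le_radius[OF net]) auto
    also have "\<dots> = ennreal (2 * pi) * (2 + of_nat k)"
      by (simp add: ennreal_mult ennreal_of_nat_eq_real_of_nat add.commute flip: ennreal_numeral ennreal_plus)
    also have "\<dots> \<le> ennreal (2 * pi) * (2 + cap_bound F C v e)"
      by (intro mult_left_mono add_left_mono n_le) (auto simp: k_def dest: not_less_Least)
    finally show ?thesis .
  qed
qed

lemma hausdorff1_frontier_le:
  assumes F: "finite F" and net: "\<And>d. norm d = 1 \<Longrightarrow> \<exists>f\<in>F. dist d f \<le> 1 / 128"
    and m: "2 < m" and n: "0 < n"
    and h: "h = (m - 2) / real n" and x: "\<And>i. x i = 1 + real i * h"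
  shows "hausdorff1 (frontier C) \<le>
     ennreal (2 * pi) * (2 + cap_bound F C v e) + ennreal (2 * pi) * (2 + cap_bound F C (v + m *\<^sub>R e) (- e))
     + (\<Sum>i<n. arc_bound C v e u m (x i) (x (Suc i)) + arc_bound C v e (- u) m (x i) (x (Suc i)))"
proof -
  interpret sw: cell_frame C "v + m *\<^sub>R e" "- e" u m by (rule swap)
  interpret fl: cell_frame C v e "- u" m by (rule flip)
  have hp: "0 < h" using m n by (simp add: h)
  have nh: "real n * h = m - 2" using n by (simp add: h)
  define A where "A u i = frontier C \<inter> {z. x i \<le> (z - v) \<bullet> e \<and> (z - v) \<bullet> e \<le> x (Suc i) \<and> 0 \<le> (z - v) \<bullet> u}" for u i
  define E1 where "E1 = frontier C \<inter> {z. (z - v) \<bullet> e \<le> 1}"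
  define E2 where "E2 = frontier C \<inter> {z. (z - (v + m *\<^sub>R e)) \<bullet> (- e) \<le> 1}"
  have "frontier C \<subseteq> (E1 \<union> E2) \<union> (\<Union>i\<in>{..<n}. A u i \<union> A (- u) i)"
  proof
    fix z assume z: "z \<in> frontier C"
    define t where "t = (z - v) \<bullet> e"
    consider "t \<le> 1" | "m - 1 \<le> t" | "1 < t" "t < m - 1" by linarith
    then show "z \<in> (E1 \<union> E2) \<union> (\<Union>i\<in>{..<n}. A u i \<union> A (- u) i)"
    proof cases
      case 1
      then show ?thesis using z by (simp add: E1_def t_def)
    next
      case 2
      have "(z - (v + m *\<^sub>R e)) \<bullet> (- e) = m - t"
        by (simp add: t_def inner_diff_left inner_add_left ee)
      then show ?thesis using z 2 by (simp add: E2_def)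
    next
      case 3
      define i where "i = nat \<lfloor>(t - 1) / h\<rfloor>"
      have "0 \<le> (t - 1) / h" using 3 hp by simp
      then have i: "real i \<le> (t - 1) / h" "(t - 1) / h < real i + 1"
        unfolding i_def by linarith+
      have "(t - 1) / h < real n" using 3 hp nh by (simp add: field_simps)
      then have "i < n" using i by linarith
      moreover have "x i \<le> t" "t \<le> x (Suc i)"
        using i hp by (auto simp: x field_simps)
      moreover have "0 \<le> (z - v) \<bullet> u \<or> 0 \<le> (z - v) \<bullet> (- u)" by auto
      ultimately show ?thesis using z unfolding A_def t_def by blast
    qed
  qed
  then have "hausdorff1 (frontier C) \<le> hausdorff1 ((E1 \<union> E2) \<union> (\<Union>i\<in>{..<n}. A u i \<union> A (- u) i))"
    by (rule hausdorff1_mono)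
  also have "\<dots> \<le> hausdorff1 (E1 \<union> E2) + hausdorff1 (\<Union>i\<in>{..<n}. A u i \<union> A (- u) i)"
    by (rule hausdorff1_Un_le)
  also have "\<dots> \<le> (hausdorff1 E1 + hausdorff1 E2) + (\<Sum>i<n. hausdorff1 (A u i \<union> A (- u) i))"
    by (intro add_mono hausdorff1_Un_le hausdorff1_UN_le) auto
  also have "\<dots> \<le> (ennreal (2 * pi) * (2 + cap_bound F C v e) + ennreal (2 * pi) * (2 + cap_bound F C (v + m *\<^sub>R e) (- e)))
     + (\<Sum>i<n. arc_bound C v e u m (x i) (x (Suc i)) + arc_bound C v e (- u) m (x i) (x (Suc i)))"
  proof (intro add_mono sum_mono)
    show "hausdorff1 E1 \<le> ennreal (2 * pi) * (2 + cap_bound F C v e)"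
      unfolding E1_def by (rule hausdorff1_cap_le[OF F net])
    show "hausdorff1 E2 \<le> ennreal (2 * pi) * (2 + cap_bound F C (v + m *\<^sub>R e) (- e))"
      unfolding E2_def by (rule sw.hausdorff1_cap_le[OF F net])
    fix i assume i: "i \<in> {..<n}"
    have "real (Suc i) * h \<le> real n * h" using i hp by (intro mult_right_mono) auto
    then have xi: "0 < x i" "x i < x (Suc i)" "x (Suc i) < m"
      using hp nh by (auto simp: x algebra_simps add_pos_nonneg)
    have "hausdorff1 (A u i \<union> A (- u) i) \<le> hausdorff1 (A u i) + hausdorff1 (A (- u) i)"
      by (rule hausdorff1_Un_le)
    also have "\<dots> \<le> arc_bound C v e u m (x i) (x (Suc i)) + arc_bound C v e (- u) m (x i) (x (Suc i))"
      unfolding A_def by (intro add_mono hausdorff1_arc_le fl.hausdorff1_arc_le xi)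
    finally show "hausdorff1 (A u i \<union> A (- u) i) \<le> \<dots>" .
  qed
  finally show ?thesis .
qed

end

section \<open>Lines as affine functions\<close>

text \<open>
  The signed distance from the line with parameters \<open>p\<close>.
\<close>

definition side :: "real \<times> real \<Rightarrow> real^2 \<Rightarrow> real" where
  "side p x = x \<bullet> vector [- sin (snd p), cos (snd p)] - fst p"

lemma line_of_eq_side: "line_of p = {x. side p x = 0}"
  by (auto simp: line_of_def side_def split: prod.splits)

lemma side_eq: "side p x = x$2 * cos (snd p) - x$1 * sin (snd p) - fst p"
  by (simp add: side_def inner_vec_def sum_2)

lemma side_zero [simp]: "side p 0 = - fst p"
  by (simp add: side_def)

lemma side_affine: "side p ((1 - t) *\<^sub>R x + t *\<^sub>R y) = (1 - t) * side p x + t * side p y"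
  by (simp add: side_def inner_add_left algebra_simps)

lemma norm_line_normal: "norm (vector [- sin t, cos t] :: real^2) = 1"
  by (simp add: norm_eq_sqrt_inner inner_vec_def sum_2 flip: power2_eq_square)

lemma side_diff_le: "\<bar>side p x - side p y\<bar> \<le> dist x y"
proof -
  have "\<bar>(x - y) \<bullet> vector [- sin (snd p), cos (snd p)]\<bar> \<le> norm (x - y)"
    using Cauchy_Schwarz_ineq2[of "x - y"] by (metis mult.right_neutral norm_line_normal)
  then show ?thesis by (simp add: side_def dist_norm inner_diff_left)
qed

lemma continuous_on_side_param: "continuous_on S (\<lambda>p. side p x)"
  unfolding side_eq by (intro continuous_intros)

lemma continuous_on_side_point: "continuous_on S (side p)"
  unfolding side_eq by (intro continuous_intros)

lemma borel_measurable_side [measurable]: "(\<lambda>p. side p x) \<in> borel_measurable borel"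
  by (intro borel_measurable_continuous_onI continuous_on_side_param)

lemma line_meets_segment_iff:
  "line_of p \<inter> closed_segment x y \<noteq> {} \<longleftrightarrow> side p x * side p y \<le> 0"
proof
  assume "line_of p \<inter> closed_segment x y \<noteq> {}"
  then obtain t where t: "0 \<le> t" "t \<le> 1" "(1 - t) * side p x + t * side p y = 0"
    by (auto simp: line_of_eq_side closed_segment_def side_affine)
  show "side p x * side p y \<le> 0"
  proof (rule ccontr)
    assume "\<not> side p x * side p y \<le> 0"
    then have "side p x * side p y > 0" by simp
    then consider "side p x > 0" "side p y > 0" | "side p x < 0" "side p y < 0"
      by (auto simp: zero_less_mult_iff)
    then show False
    proof cases
      case 1
      then have "(1 - t) * side p x \<ge> 0" "t * side p y \<ge> 0" using t by auto
      with t(3) have "(1 - t) * side p x = 0" "t * side p y = 0" by linarith+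
      then show False using 1 by auto
    next
      case 2
      then have "(1 - t) * side p x \<le> 0" "t * side p y \<le> 0"
        using t by (auto simp: mult_le_0_iff)
      with t(3) have "(1 - t) * side p x = 0" "t * side p y = 0" by linarith+
      then show False using 2 by auto
    qed
  qed
next
  assume xy: "side p x * side p y \<le> 0"
  show "line_of p \<inter> closed_segment x y \<noteq> {}"
  proof (cases "side p x = side p y")
    case True
    with xy have "side p x = 0" by (auto simp: mult_le_0_iff)
    then show ?thesis by (auto simp: line_of_eq_side)
  next
    case False
    define t where "t = side p x / (side p x - side p y)"
    have "0 \<le> t" "t \<le> 1"
      using xy False by (auto simp: t_def divide_simps mult_le_0_iff)
    moreover have "side p ((1 - t) *\<^sub>R x + t *\<^sub>R y) = 0"
      unfolding side_affine using False by (simp add: t_def field_simps)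
    ultimately show ?thesis
      by (auto simp: line_of_eq_side closed_segment_def)
  qed
qed

text \<open>
  The parameters that represent each line exactly once.
\<close>

abbreviation params :: "(real \<times> real) set" where
  "params \<equiv> UNIV \<times> {0..<pi}"

definition hits :: "real^2 \<Rightarrow> real^2 \<Rightarrow> (real \<times> real) set" where
  "hits x y = {p \<in> params. side p x * side p y \<le> 0}"

definition crosses :: "real^2 \<Rightarrow> real^2 \<Rightarrow> (real \<times> real) set" where
  "crosses x y = {p \<in> params. side p x * side p y < 0}"

definition thru :: "real^2 \<Rightarrow> (real \<times> real) set" where
  "thru x = {p \<in> params. side p x = 0}"

definition near :: "real^2 \<Rightarrow> real \<Rightarrow> (real \<times> real) set" where
  "near x r = {p \<in> params. \<bar>side p x\<bar> \<le> r}"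

text \<open>
  The lines that have \<open>v\<close> and \<open>w\<close> on one side and the ball of radius \<open>r\<close> about \<open>z\<close> on the other,
  possibly touching it. If the process contains one of them, then the cell of \<open>v\<close> and \<open>w\<close> does not
  meet that ball.
\<close>

definition cut_off :: "real^2 \<Rightarrow> real^2 \<Rightarrow> real^2 \<Rightarrow> real \<Rightarrow> (real \<times> real) set" where
  "cut_off v w z r = {p \<in> params. (side p v > 0 \<and> side p w > 0 \<and> side p z \<le> - r)
                               \<or> (side p v < 0 \<and> side p w < 0 \<and> r \<le> side p z)}"

lemma bounded_near: "bounded (near 0 r)"
proof (rule bounded_subset)
  show "bounded ({-r..r} \<times> {0..pi})" by (intro bounded_Times) auto
qed (auto simp: near_def)

lemma hits_subset_near: "hits x y \<subseteq> near x (dist x y)"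
proof
  fix p assume "p \<in> hits x y"
  then have "p \<in> params" "\<bar>side p x\<bar> \<le> \<bar>side p x - side p y\<bar>"
    by (auto simp: hits_def mult_le_0_iff)
  then show "p \<in> near x (dist x y)"
    using side_diff_le[of p x y] by (auto simp: near_def)
qed

lemma near_subset_near_0: "near x r \<subseteq> near 0 (r + norm x)"
proof
  fix p assume "p \<in> near x r"
  then show "p \<in> near 0 (r + norm x)"
    using side_diff_le[of p x 0] by (auto simp: near_def)
qed

lemma bounded_hits: "bounded (hits x y)"
  using hits_subset_near near_subset_near_0 bounded_near bounded_subset by meson

lemma crosses_subset_hits: "crosses x y \<subseteq> hits x y"
  by (auto simp: crosses_def hits_def)

lemma thru_subset_hits: "thru x \<subseteq> hits x y"
  by (auto simp: thru_def hits_def)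

lemma cut_off_subset_hits: "r \<ge> 0 \<Longrightarrow> cut_off v w z r \<subseteq> hits v z"
  by (auto simp: cut_off_def hits_def mult_le_0_iff)

section \<open>Counts of a Poisson process\<close>

context poisson_point_process
begin

text \<open>
  The mean of the Poisson law. This translates unit intensity, a statement about expected counts,
  into a statement about the intensity measure.
\<close>

lemma nn_integral_num_points:
  assumes B: "B \<in> sets \<mu>" "bounded B"
  shows "(\<integral>\<^sup>+\<omega>. num_points X B \<omega> \<partial>M) = emeasure \<mu> B"
proof -
  define l where "l = measure \<mu> B"
  have fin: "emeasure \<mu> B < \<infinity>" by (rule intensity_locally_finite[OF B])
  define A where "A k = {\<omega> \<in> space M. num_points X B \<omega> = of_nat k}" for k :: nat
  have [measurable]: "num_points X B \<in> borel_measurable M"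
    by (rule num_points_measurable[OF B(1)])
  have A[measurable]: "A k \<in> sets M" for k unfolding A_def by measurable
  have "num_points X B \<omega> = (\<Sum>k. of_nat k * indicator (A k) \<omega>)" if "\<omega> \<in> space M" for \<omega>
  proof -
    have "finite (X \<omega> \<inter> B)" by (rule locally_finite[OF that B(2)])
    then obtain n where n: "num_points X B \<omega> = of_nat n"
      by (simp add: num_points_def)
    have "(\<Sum>k. of_nat k * indicator (A k) \<omega>) = (\<Sum>k\<in>{n}. of_nat k * (indicator (A k) \<omega> :: ennreal))"
      by (rule suminf_finite) (auto simp: A_def n indicator_def)
    also have "\<dots> = of_nat n"
      using that by (simp add: A_def n)
    finally show ?thesis by (simp add: n)
  qed
  then have "(\<integral>\<^sup>+\<omega>. num_points X B \<omega> \<partial>M) = (\<integral>\<^sup>+\<omega>. (\<Sum>k. of_nat k * indicator (A k) \<omega>) \<partial>M)"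
    by (intro nn_integral_cong) auto
  also have "\<dots> = (\<Sum>k. \<integral>\<^sup>+\<omega>. of_nat k * indicator (A k) \<omega> \<partial>M)"
    by (rule nn_integral_suminf) measurable
  also have "\<dots> = (\<Sum>k. of_nat k * emeasure M (A k))"
    by (simp add: nn_integral_cmult_indicator)
  also have "\<dots> = (\<Sum>k. ennreal (real k * (l ^ k / fact k * exp (- l))))"
  proof (intro suminf_cong)
    fix k
    have "emeasure M (A k) = ennreal (l ^ k / fact k * exp (- l))"
      unfolding emeasure_eq_measure A_def l_def using num_points_poisson[OF B(1) fin] by simp
    then show "of_nat k * emeasure M (A k) = ennreal (real k * (l ^ k / fact k * exp (- l)))"
      by (simp only: ennreal_mult'[of "real k"] of_nat_0_le_iff ennreal_of_nat_eq_real_of_nat)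
  qed
  also have "\<dots> = ennreal l"
  proof (rule suminf_ennreal_eq)
    show "0 \<le> real k * (l ^ k / fact k * exp (- l))" for k
      by (simp add: l_def)
    have "(\<lambda>k. (l ^ k / fact k) * (l * exp (- l))) sums (exp l * (l * exp (- l)))"
      using exp_converges[of l] by (intro sums_mult2) (simp add: divide_inverse mult.commute)
    moreover have "exp l * (l * exp (- l)) = l"
      by (simp add: exp_minus)
    moreover have "(\<lambda>k. (l ^ k / fact k) * (l * exp (- l))) = (\<lambda>k.  real (Suc k) * (l ^ Suc k / fact (Suc k) * exp (- l)))"
      by (simp add: fun_eq_iff divide_simps)
    ultimately have "(\<lambda>k. real (Suc k) * (l ^ Suc k / fact (Suc k) * exp (- l))) sums l"
      by metis
    then show "(\<lambda>k. real k * (l ^ k / fact k * exp (- l))) sums l"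
      by (subst (asm) sums_Suc_iff) simp
  qed
  also have "\<dots> = emeasure \<mu> B"
    unfolding l_def using fin by (intro emeasure_eq_ennreal_measure[symmetric]) auto
  finally show ?thesis .
qed

lemma prob_no_points:
  assumes B: "B \<in> sets \<mu>" "bounded B"
  shows "{\<omega> \<in> space M. X \<omega> \<inter> B = {}} \<in> sets M"
    and "prob {\<omega> \<in> space M. X \<omega> \<inter> B = {}} = exp (- measure \<mu> B)"
proof -
  have eq: "{\<omega> \<in> space M. X \<omega> \<inter> B = {}} = {\<omega> \<in> space M. num_points X B \<omega> = of_nat 0}"
    by (auto simp: num_points_def emeasure_count_space_eq_0)
  have [measurable]: "num_points X B \<in> borel_measurable M"
    by (rule num_points_measurable[OF B(1)])
  show "{\<omega> \<in> space M. X \<omega> \<inter> B = {}} \<in> sets M" unfolding eq by measurable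
  show "prob {\<omega> \<in> space M. X \<omega> \<inter> B = {}} = exp (- measure \<mu> B)"
    unfolding eq using num_points_poisson[OF B(1) intensity_locally_finite[OF B], of 0] by simp
qed

end

section \<open>The Crofton formula up to an additive constant\<close>

locale unit_poisson_line_process = stationary_isotropic_poisson_line_process +
  assumes unit: "unit_intensity M L"
begin

lemma space_intensity: "space \<mu> = params"
  using sets_eq_imp_space_eq[OF sets_intensity] by (simp add: line_space_def space_restrict_space)

lemma lines_in_params: "\<omega> \<in> space M \<Longrightarrow> L \<omega> \<subseteq> params"
  using points_in_space space_intensity by auto

lemma sets_paramsI:
  assumes "{p. P p} \<in> sets borel"
  shows "{p \<in> params. P p} \<in> sets \<mu>"
proof -
  have "{p \<in> params. P p} = params \<inter> {p. P p}" by auto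
  also have "\<dots> \<in> sets (restrict_space borel params)"
    unfolding sets_restrict_space using assms by blast
  finally show ?thesis by (simp add: sets_intensity line_space_def)
qed

lemma sets_line_events [simp]:
  "hits x y \<in> sets \<mu>" "crosses x y \<in> sets \<mu>" "thru x \<in> sets \<mu>" "near x r \<in> sets \<mu>"
  "cut_off v w z r \<in> sets \<mu>"
  unfolding hits_def crosses_def thru_def near_def cut_off_def
  by (intro sets_paramsI; measurable)+

lemma fmeasurable_line_event:
  assumes "B \<in> sets \<mu>" "bounded B"
  shows "B \<in> fmeasurable \<mu>"
  using intensity_locally_finite[OF assms] assms by (simp add: fmeasurable_def)

lemma fmeasurable_line_events [simp]:
  "hits x y \<in> fmeasurable \<mu>" "crosses x y \<in> fmeasurable \<mu>" "thru x \<in> fmeasurable \<mu>"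
  "near x r \<in> fmeasurable \<mu>" "r \<ge> 0 \<Longrightarrow> cut_off v w z r \<in> fmeasurable \<mu>"
proof -
  show "hits x y \<in> fmeasurable \<mu>"
    by (intro fmeasurable_line_event bounded_hits) simp
  show "crosses x y \<in> fmeasurable \<mu>"
    by (intro fmeasurable_line_event bounded_subset[OF bounded_hits crosses_subset_hits]) simp
  show "thru x \<in> fmeasurable \<mu>"
    by (intro fmeasurable_line_event bounded_subset[OF bounded_hits thru_subset_hits]) simp
  show "near x r \<in> fmeasurable \<mu>"
    by (intro fmeasurable_line_event bounded_subset[OF bounded_near near_subset_near_0]) simp
  show "cut_off v w z r \<in> fmeasurable \<mu>" if "r \<ge> 0"
    by (intro fmeasurable_line_event bounded_subset[OF bounded_hits cut_off_subset_hits[OF that]]) simp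
qed

lemma measure_thru_translate: "measure \<mu> (thru (x - a)) = measure \<mu> (thru x)"
proof -
  have "{p \<in> space \<mu>. (\<lambda>z. a + z) ` line_of p \<in> line_of ` thru x} = thru (x - a)"
  proof (intro equalityI subsetI)
    fix p assume "p \<in> {p \<in> space \<mu>. (\<lambda>z. a + z) ` line_of p \<in> line_of ` thru x}"
    then obtain q where p: "p \<in> params" and q: "q \<in> thru x" "(\<lambda>z. a + z) ` line_of p = line_of q"
      by (auto simp: space_intensity)
    then have "x \<in> (\<lambda>z. a + z) ` line_of p"
      by (auto simp: line_of_eq_side thru_def)
    then have "x - a \<in> line_of p" by auto
    then show "p \<in> thru (x - a)"
      using p by (auto simp: line_of_eq_side thru_def)
  next
    fix p assume p: "p \<in> thru (x - a)"
    define q where "q = (fst p + a \<bullet> vector [- sin (snd p), cos (snd p)], snd p)"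
    have sq: "side q z = side p (z - a)" for z
      by (simp add: side_def q_def inner_diff_left)
    have "q \<in> thru x"
      using p sq by (auto simp: thru_def q_def)
    moreover have "(\<lambda>z. a + z) ` line_of p = line_of q"
    proof (intro equalityI subsetI)
      fix z assume "z \<in> line_of q"
      then show "z \<in> (\<lambda>z. a + z) ` line_of p"
        by (intro image_eqI[of _ _ "z - a"]) (auto simp: line_of_eq_side sq)
    qed (auto simp: line_of_eq_side sq)
    ultimately show "p \<in> {p \<in> space \<mu>. (\<lambda>z. a + z) ` line_of p \<in> line_of ` thru x}"
      using p by (auto simp: space_intensity thru_def)
  qed
  moreover have "emeasure \<mu> {p \<in> space \<mu>. (\<lambda>z. a + z) ` line_of p \<in> line_of ` thru x} = emeasure \<mu> (thru x)"
    by (rule bspec[OF translation_invariant[unfolded invariant_under_def]]) simp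
  ultimately show ?thesis
    by (simp add: measure_def)
qed

text \<open>
  A line meets a parabola in at most two points.
\<close>

lemma card_parabola_thru_le:
  "finite {t. p \<in> thru (vector [t, t\<^sup>2])}" "card {t. p \<in> thru (vector [t, t\<^sup>2])} \<le> 2"
proof -
  define P where "P = [: - fst p, - sin (snd p), cos (snd p) :]"
  have "P \<noteq> 0"
    unfolding P_def using sin_cos_squared_add[of "snd p"] by (auto simp del: sin_cos_squared_add)
  have sub: "{t. p \<in> thru (vector [t, t\<^sup>2])} \<subseteq> {t. poly P t = 0}"
    by (auto simp: thru_def side_eq P_def power2_eq_square algebra_simps)
  have "card {t. poly P t = 0} \<le> degree P"
    using \<open>P \<noteq> 0\<close> by (rule card_poly_roots_bound)
  moreover have "degree P \<le> 2"
    by (simp add: P_def)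
  moreover have fin: "finite {t. poly P t = 0}"
    using \<open>P \<noteq> 0\<close> by (rule poly_roots_finite)
  ultimately show "finite {t. p \<in> thru (vector [t, t\<^sup>2])}" "card {t. p \<in> thru (vector [t, t\<^sup>2])} \<le> 2"
    using finite_subset[OF sub] card_mono[OF fin sub] by linarith+
qed

text \<open>
  By translation invariance all pencils of lines through a point have the same measure. Infinitely many
  points on a bounded piece of a parabola have pencils that cover each line at most twice,
  so \<open>n\<close> times that measure stays below a constant, for every \<open>n\<close>.
\<close>

lemma measure_thru [simp]: "measure \<mu> (thru x) = 0"
proof -
  define y :: "nat \<Rightarrow> real^2" where "y i = vector [1 / real (Suc i), (1 / real (Suc i))\<^sup>2]" for i
  have mu: "measure \<mu> (thru (y i)) = measure \<mu> (thru x)" for i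
    using measure_thru_translate[of x "x - y i"] by simp
  have int [simp]: "integrable \<mu> (indicator B :: real \<times> real \<Rightarrow> real)" if "B \<in> fmeasurable \<mu>" for B
    using that by (auto simp: fmeasurable_def)
  have le2: "(\<Sum>i<n. indicator (thru (y i)) p) \<le> (2 * indicator (near 0 2) p :: real)" for n p
  proof -
    define I where "I = {i\<in>{..<n}. p \<in> thru (y i)}"
    have sum: "(\<Sum>i<n. indicator (thru (y i)) p) = real (card I)"
      unfolding I_def by (simp add: indicator_def sum.If_cases Int_def)
    have "card I \<le> card {t. p \<in> thru (vector [t, t\<^sup>2])}"
      by (rule card_inj_on_le[of "\<lambda>i. 1 / real (Suc i)"])
         (auto simp: I_def y_def inj_on_def card_parabola_thru_le(1))
    also have "\<dots> \<le> 2" by (rule card_parabola_thru_le)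
    finally have "card I \<le> 2" .
    moreover have "I = {}" if "p \<notin> near 0 2"
    proof -
      have "p \<in> near 0 2" if "p \<in> thru (y i)" for i
      proof -
        have "norm (y i) \<le> \<bar>y i $ 1\<bar> + \<bar>y i $ 2\<bar>"
          using norm_le_l1_cart[of "y i"] by (simp add: sum_2)
        also have "\<dots> \<le> 1 + 1"
          by (intro add_mono) (auto simp: y_def power_le_one divide_simps)
        finally show ?thesis
          using that side_diff_le[of p "y i" 0] by (auto simp: thru_def near_def)
      qed
      then show ?thesis using that by (auto simp: I_def)
    qed
    ultimately show ?thesis
      unfolding sum by (cases "p \<in> near 0 2") auto
  qed
  have "real n * measure \<mu> (thru x) \<le> 2 * measure \<mu> (near 0 2)" for n
  proof -
    have "real n * measure \<mu> (thru x) = (\<Sum>i<n. measure \<mu> (thru (y i)))"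
      by (simp add: mu)
    also have "\<dots> = (\<integral>p. (\<Sum>i<n. indicator (thru (y i)) p) \<partial>\<mu>)"
      by (subst Bochner_Integration.integral_sum) auto
    also have "\<dots> \<le> (\<integral>p. 2 * indicator (near 0 2) p \<partial>\<mu>)"
      by (intro integral_mono le2) auto
    also have "\<dots> = 2 * measure \<mu> (near 0 2)" by simp
    finally show ?thesis .
  qed
  then have "\<not> 0 < measure \<mu> (thru x)"
    using ex_less_of_nat_mult[of "measure \<mu> (thru x)"] by (meson linorder_not_le)
  then show ?thesis using measure_nonneg[of \<mu> "thru x"] by linarith
qed

lemma measure_hits_unit:
  assumes "dist x y = 1"
  shows "measure \<mu> (hits x y) = 1"
proof -
  have "num_points L {p. line_of p \<inter> closed_segment x y \<noteq> {}} \<omega> = num_points L (hits x y) \<omega>"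
    if "\<omega> \<in> space M" for \<omega>
  proof -
    have "L \<omega> \<inter> {p. line_of p \<inter> closed_segment x y \<noteq> {}} = L \<omega> \<inter> hits x y"
      using lines_in_params[OF that] by (auto simp: line_meets_segment_iff hits_def)
    then show ?thesis by (simp add: num_points_def)
  qed
  then have "(\<integral>\<^sup>+\<omega>. num_points L (hits x y) \<omega> \<partial>M) = 1"
    using unit assms unfolding unit_intensity_def by (metis (mono_tags, lifting) nn_integral_cong)
  then have "emeasure \<mu> (hits x y) = 1"
    by (simp add: nn_integral_num_points bounded_hits)
  then show ?thesis by (simp add: measure_def)
qed

lemma measure_crosses_unit:
  assumes "dist x y = 1"
  shows "measure \<mu> (crosses x y) \<ge> 1"
proof -
  have "hits x y \<subseteq> crosses x y \<union> (thru x \<union> thru y)"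
    by (auto simp: hits_def crosses_def thru_def mult_less_0_iff mult_le_0_iff)
  then have "measure \<mu> (hits x y) \<le> measure \<mu> (crosses x y \<union> (thru x \<union> thru y))"
    by (intro measure_mono_fmeasurable fmeasurable.Un) auto
  also have "\<dots> \<le> measure \<mu> (crosses x y) + measure \<mu> (thru x \<union> thru y)"
    by (intro measure_Un_le) auto
  also have "measure \<mu> (thru x \<union> thru y) \<le> measure \<mu> (thru x) + measure \<mu> (thru y)"
    by (intro measure_Un_le) auto
  finally show ?thesis by (simp add: measure_hits_unit assms)
qed

text \<open>
  A line that separates \<open>x\<close> from \<open>x + a u\<close> also separates \<open>x\<close> from every point beyond
  \<open>x + a u\<close> on the same ray; \<open>s + t c\<close> is the signed distance along the ray.
\<close>

lemma sign_change_mono: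
  fixes s :: real
  assumes "0 \<le> a" "a \<le> b"
  shows "s * (s + a * c) < 0 \<Longrightarrow> s * (s + b * c) < 0"
    and "s * (s + a * c) \<le> 0 \<Longrightarrow> s * (s + b * c) \<le> 0"
proof -
  have eq: "s * (s + t * c) = s\<^sup>2 + t * (s * c)" for t
    by (simp add: power2_eq_square algebra_simps)
  have neg: "s * c \<le> 0" if "s * (s + a * c) \<le> 0"
  proof (rule ccontr)
    assume *: "\<not> s * c \<le> 0"
    then have "s \<noteq> 0" by auto
    then have "s\<^sup>2 > 0" by simp
    moreover have "a * (s * c) \<ge> 0" using * assms(1) by simp
    ultimately show False using that unfolding eq by linarith
  qed
  have le: "s * (s + b * c) \<le> s * (s + a * c)" if "s * (s + a * c) \<le> 0"
    unfolding eq using mult_right_mono_neg[OF assms(2) neg[OF that]] by simp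
  show "s * (s + a * c) < 0 \<Longrightarrow> s * (s + b * c) < 0"
    using le by force
  show "s * (s + a * c) \<le> 0 \<Longrightarrow> s * (s + b * c) \<le> 0"
    using le by force
qed

lemma side_along: "side p (x + t *\<^sub>R u) = side p x + t * (side p (x + u) - side p x)"
  by (simp add: side_def inner_add_left)

text \<open>
  Chop the segment into unit pieces. No line crosses two of them strictly, so their measures add up.
\<close>

lemma measure_crosses_ge_nat:
  assumes "norm u = 1"
  shows "real n \<le> measure \<mu> (crosses x (x + real n *\<^sub>R u))"
proof (induction n)
  case (Suc n)
  define y where "y = x + real n *\<^sub>R u"
  have xSuc: "x + real (Suc n) *\<^sub>R u = y + u"
    by (simp add: y_def algebra_simps)
  have sy: "side p y = side p x + real n * (side p (x + u) - side p x)"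
    and syu: "side p (y + u) = side p x + (real n + 1) * (side p (x + u) - side p x)" for p
    by (simp_all add: y_def side_def inner_add_left algebra_simps)
  show ?case
  proof -
    have disj: "crosses x y \<inter> crosses y (y + u) = {}"
    proof safe
      fix p assume p: "p \<in> crosses x y" "p \<in> crosses y (y + u)"
      define s c where "s = side p x" and "c = side p (x + u) - side p x"
      have y: "side p y = s + real n * c" "side p (y + u) = side p y + c"
        unfolding sy syu s_def c_def by (simp_all add: algebra_simps)
      have "s * side p y < 0" "side p y * (side p y + c) < 0"
        using p unfolding y(2)[symmetric] by (simp_all add: crosses_def s_def)
      then have "s\<^sup>2 + real n * (s * c) < 0" "(side p y)\<^sup>2 + side p y * c < 0"
        by (simp_all add: y power2_eq_square algebra_simps)
      moreover have "real n * (s * c) \<ge> 0" if "s * c \<ge> 0" using that by simp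
      ultimately have "s * c < 0" "side p y * c < 0"
        using zero_le_power2[of s] zero_le_power2[of "side p y"] by linarith+
      then have "0 < (s * c) * (side p y * c)" by (rule mult_neg_neg)
      also have "\<dots> = (s * side p y) * c\<^sup>2" by (simp add: power2_eq_square)
      also have "\<dots> \<le> 0"
        by (rule mult_nonpos_nonneg[OF less_imp_le[OF \<open>s * side p y < 0\<close>]]) simp
      finally show "p \<in> {}" by simp
    qed
    have sub: "crosses x y \<union> crosses y (y + u) \<subseteq> crosses x (y + u)"
    proof
      fix p assume "p \<in> crosses x y \<union> crosses y (y + u)"
      then show "p \<in> crosses x (y + u)"
      proof
        assume "p \<in> crosses x y"
        then show ?thesis
          using sign_change_mono(1)[of "real n" "real n + 1" "side p x"] unfolding crosses_def sy syu by auto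
      next
        assume p: "p \<in> crosses y (y + u)"
        define z c where "z = side p (y + u)" and "c = side p x - side p (x + u)"
        have "side p y = z + 1 * c" "side p x = z + (real n + 1) * c"
          unfolding sy syu z_def c_def by (simp_all add: algebra_simps)
        moreover from this have "z * (z + 1 * c) < 0"
          using p by (simp add: crosses_def z_def mult.commute)
        then have "z * (z + (real n + 1) * c) < 0"
          by (rule sign_change_mono(1)[rotated 2]) auto
        ultimately show ?thesis
          using p by (simp add: crosses_def z_def mult.commute)
      qed
    qed
    have "real n + 1 \<le> measure \<mu> (crosses x y) + measure \<mu> (crosses y (y + u))"
      using Suc.IH measure_crosses_unit[of y "y + u"] assms
      by (intro add_mono) (auto simp: y_def dist_norm)
    also have "\<dots> = measure \<mu> (crosses x y \<union> crosses y (y + u))"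
      using disj by (intro measure_Un_AE[symmetric]) auto
    also have "\<dots> \<le> measure \<mu> (crosses x (y + u))"
      using sub by (intro measure_mono_fmeasurable) auto
    finally show ?thesis unfolding xSuc by simp
  qed
qed auto

lemma measure_hits_le_nat:
  assumes "norm u = 1"
  shows "measure \<mu> (hits x (x + real n *\<^sub>R u)) \<le> real n"
proof (induction n)
  case 0
  have "hits x x = thru x" by (auto simp: hits_def thru_def mult_le_0_iff)
  then show ?case by simp
next
  case (Suc n)
  define y where "y = x + real n *\<^sub>R u"
  have xSuc: "x + real (Suc n) *\<^sub>R u = y + u"
    by (simp add: y_def algebra_simps)
  have "hits x (y + u) \<subseteq> hits x y \<union> hits y (y + u)"
    by (auto simp: hits_def mult_le_0_iff)
  then have "measure \<mu> (hits x (y + u)) \<le> measure \<mu> (hits x y \<union> hits y (y + u))"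
    by (intro measure_mono_fmeasurable fmeasurable.Un) auto
  also have "\<dots> \<le> measure \<mu> (hits x y) + measure \<mu> (hits y (y + u))"
    by (intro measure_Un_le) auto
  also have "\<dots> \<le> real n + 1"
    using Suc.IH measure_hits_unit[of y "y + u"] assms
    by (intro add_mono) (auto simp: y_def dist_norm)
  finally show ?case unfolding xSuc by simp
qed

text \<open>
  Compare the segment with segments on the same ray whose lengths are the integers next to \<open>dist x y\<close>.
\<close>

lemma measure_crosses_ge: "dist x y - 1 \<le> measure \<mu> (crosses x y)"
  and measure_hits_le: "measure \<mu> (hits x y) \<le> dist x y + 1"
proof -
  have "dist x y - 1 \<le> measure \<mu> (crosses x y) \<and> measure \<mu> (hits x y) \<le> dist x y + 1"
  proof (cases "x = y")
    case True
    have "hits x x = thru x" by (auto simp: hits_def thru_def mult_le_0_iff)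
    then show ?thesis using True by (simp add: add_nonneg_nonneg order_trans[of _ 0])
  next
    case False
    define d where "d = dist x y"
    define u where "u = (1 / d) *\<^sub>R (y - x)"
    have d: "d > 0" using False by (simp add: d_def)
    have u: "norm u = 1" using False by (simp add: u_def d_def dist_norm norm_minus_commute)
    have y: "y = x + d *\<^sub>R u" using d by (simp add: u_def)
    define n where "n = nat \<lfloor>d\<rfloor>"
    have n: "real n \<le> d" "d < real n + 1" using d unfolding n_def by linarith+
    define k where "k = nat \<lceil>d\<rceil>"
    have k: "d \<le> real k" "real k < d + 1" using d unfolding k_def by linarith+
    have "crosses x (x + real n *\<^sub>R u) \<subseteq> crosses x y"
    proof
      fix p assume "p \<in> crosses x (x + real n *\<^sub>R u)"
      then show "p \<in> crosses x y"
        using sign_change_mono(1)[of "real n" d "side p x"] n unfolding y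
        by (auto simp: crosses_def side_along[of p x])
    qed
    then have "measure \<mu> (crosses x (x + real n *\<^sub>R u)) \<le> measure \<mu> (crosses x y)"
      by (intro measure_mono_fmeasurable) auto
    then have 1: "d - 1 \<le> measure \<mu> (crosses x y)"
      using measure_crosses_ge_nat[OF u, of n x] n by linarith
    have "hits x y \<subseteq> hits x (x + real k *\<^sub>R u)"
    proof
      fix p assume "p \<in> hits x y"
      then show "p \<in> hits x (x + real k *\<^sub>R u)"
        using sign_change_mono(2)[of d "real k" "side p x"] d k unfolding y
        by (auto simp: hits_def side_along[of p x])
    qed
    then have "measure \<mu> (hits x y) \<le> measure \<mu> (hits x (x + real k *\<^sub>R u))"
      by (intro measure_mono_fmeasurable) auto
    then have "measure \<mu> (hits x y) \<le> d + 1"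
      using measure_hits_le_nat[OF u, of x k] k by linarith
    with 1 show ?thesis by (simp add: d_def)
  qed
  then show "dist x y - 1 \<le> measure \<mu> (crosses x y)" "measure \<mu> (hits x y) \<le> dist x y + 1" by auto
qed

text \<open>
  A line at distance at most \<open>r\<close> from \<open>z\<close> makes an angle of at least 45 degrees with one of the
  coordinate axes, hence hits the segment of half-length \<open>2 r\<close> about \<open>z\<close> in that direction.
\<close>

lemma measure_near_le:
  assumes r: "r \<ge> 0"
  shows "measure \<mu> (near z r) \<le> 8 * r + 2"
proof -
  define a b :: "real^2" where "a = vector [2 * r, 0]" and "b = vector [0, 2 * r]"
  have sub: "near z r \<subseteq> hits (z - a) (z + a) \<union> hits (z - b) (z + b)"
  proof
    fix p assume p: "p \<in> near z r"
    then have s: "(side p z)\<^sup>2 \<le> r\<^sup>2"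
      by (auto simp: near_def abs_le_square_iff[symmetric] r)
    have "side p (z - a) * side p (z + a) = (side p z)\<^sup>2 - 4 * r\<^sup>2 * (sin (snd p))\<^sup>2"
      "side p (z - b) * side p (z + b) = (side p z)\<^sup>2 - 4 * r\<^sup>2 * (cos (snd p))\<^sup>2"
      by (simp_all add: side_eq a_def b_def power2_eq_square algebra_simps)
    moreover have "(side p z)\<^sup>2 \<le> 4 * r\<^sup>2 * (sin (snd p))\<^sup>2 \<or> (side p z)\<^sup>2 \<le> 4 * r\<^sup>2 * (cos (snd p))\<^sup>2"
    proof -
      have "1 \<le> 4 * (sin (snd p))\<^sup>2 \<or> 1 \<le> 4 * (cos (snd p))\<^sup>2"
        using sin_cos_squared_add[of "snd p"] by linarith
      then show ?thesis
      proof
        assume "1 \<le> 4 * (sin (snd p))\<^sup>2"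
        then have "r\<^sup>2 * 1 \<le> r\<^sup>2 * (4 * (sin (snd p))\<^sup>2)" by (intro mult_left_mono) auto
        then show ?thesis using s by (simp add: mult_ac)
      next
        assume "1 \<le> 4 * (cos (snd p))\<^sup>2"
        then have "r\<^sup>2 * 1 \<le> r\<^sup>2 * (4 * (cos (snd p))\<^sup>2)" by (intro mult_left_mono) auto
        then show ?thesis using s by (simp add: mult_ac)
      qed
    qed
    ultimately show "p \<in> hits (z - a) (z + a) \<union> hits (z - b) (z + b)"
      using p by (auto simp: hits_def near_def)
  qed
  have na: "norm (2 *\<^sub>R a) = 4 * r" "norm (2 *\<^sub>R b) = 4 * r"
    using r by (simp_all add: norm_eq_sqrt_inner inner_vec_def sum_2 a_def b_def real_sqrt_mult)
  have d: "dist (z - a) (z + a) = 4 * r" "dist (z - b) (z + b) = 4 * r"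
    using na by (simp_all add: dist_norm scaleR_2 norm_minus_commute[of "z - _"])
  have "measure \<mu> (near z r) \<le> measure \<mu> (hits (z - a) (z + a) \<union> hits (z - b) (z + b))"
    using sub by (intro measure_mono_fmeasurable fmeasurable.Un) auto
  also have "\<dots> \<le> measure \<mu> (hits (z - a) (z + a)) + measure \<mu> (hits (z - b) (z + b))"
    by (intro measure_Un_le) auto
  also have "\<dots> \<le> (4 * r + 1) + (4 * r + 1)"
    by (intro add_mono order_trans[OF measure_hits_le]) (auto simp: d)
  finally show ?thesis by simp
qed

text \<open>
  Up to lines through \<open>v\<close> or \<open>w\<close> and lines close to \<open>z\<close>, a line that crosses the side \<open>vz\<close> of the
  triangle \<open>vwz\<close> either cuts off \<open>z\<close> or crosses \<open>vw\<close>, and likewise for \<open>wz\<close>. The lines that cross \<open>vw\<close>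
  cross only one of the other two sides, so they are counted once when both statements are added.
\<close>

lemma measure_cut_off_ge:
  assumes r: "r \<ge> 0"
  shows "(dist v z + dist w z - dist v w) / 2 - (7 / 2 + 8 * r) \<le> measure \<mu> (cut_off v w z r)"
proof -
  define B where "B = cut_off v w z r"
  define D1 where "D1 = crosses v z \<inter> crosses v w"
  define D2 where "D2 = crosses w z \<inter> crosses v w"
  have bound: "dist x z - 1 \<le> measure \<mu> B + measure \<mu> D + (8 * r + 2)"
    if sub: "crosses x z \<subseteq> B \<union> (D \<union> (near z r \<union> thru y))" and D: "D \<in> fmeasurable \<mu>" for x y D
  proof -
    have "measure \<mu> (crosses x z) \<le> measure \<mu> (B \<union> (D \<union> (near z r \<union> thru y)))"
      using sub D r by (intro measure_mono_fmeasurable fmeasurable.Un) (auto simp: B_def)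
    also have "\<dots> \<le> measure \<mu> B + measure \<mu> (D \<union> (near z r \<union> thru y))"
      using D by (intro measure_Un_le sets.Un) (auto simp: B_def)
    also have "measure \<mu> (D \<union> (near z r \<union> thru y)) \<le> measure \<mu> D + measure \<mu> (near z r \<union> thru y)"
      using D by (intro measure_Un_le sets.Un) auto
    also have "measure \<mu> (near z r \<union> thru y) \<le> measure \<mu> (near z r) + measure \<mu> (thru y)"
      by (intro measure_Un_le) auto
    finally show ?thesis
      using measure_crosses_ge[of x z] measure_near_le[OF r, of z] by simp
  qed
  have D: "D1 \<in> fmeasurable \<mu>" "D2 \<in> fmeasurable \<mu>"
    unfolding D1_def D2_def by (intro fmeasurable_Int_fmeasurable; simp)+
  have 1: "dist v z - 1 \<le> measure \<mu> B + measure \<mu> D1 + (8 * r + 2)"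
    by (rule bound[OF _ D(1), of v w])
       (auto simp: D1_def crosses_def B_def cut_off_def near_def thru_def mult_less_0_iff)
  have 2: "dist w z - 1 \<le> measure \<mu> B + measure \<mu> D2 + (8 * r + 2)"
    by (rule bound[OF _ D(2), of w v])
       (auto simp: D2_def crosses_def B_def cut_off_def near_def thru_def mult_less_0_iff)
  have "measure \<mu> D1 + measure \<mu> D2 = measure \<mu> (D1 \<union> D2)"
    by (rule measure_Un_AE[symmetric])
       (use D in \<open>auto simp: D1_def D2_def crosses_def mult_less_0_iff\<close>)
  also have "\<dots> \<le> measure \<mu> (crosses v w)"
    by (rule measure_mono_fmeasurable) (use D in \<open>auto simp: D1_def D2_def\<close>)
  also have "\<dots> \<le> measure \<mu> (hits v w)"
    by (rule measure_mono_fmeasurable[OF crosses_subset_hits]) auto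
  also have "\<dots> \<le> dist v w + 1"
    by (rule measure_hits_le)
  finally show ?thesis
    using 1 2 unfolding B_def[symmetric] by argo
qed

definition uncut :: "real^2 \<Rightarrow> real^2 \<Rightarrow> real^2 \<Rightarrow> real \<Rightarrow> 'a set" where
  "uncut v w z r = {\<omega> \<in> space M. L \<omega> \<inter> cut_off v w z r = {}}"

lemma sets_uncut [measurable]: "r \<ge> 0 \<Longrightarrow> uncut v w z r \<in> sets M"
  unfolding uncut_def by (intro prob_no_points bounded_subset[OF bounded_hits cut_off_subset_hits]) auto

lemma prob_uncut_le:
  assumes r: "r \<ge> 0"
  shows "prob (uncut v w z r) \<le> exp (7 / 2 + 8 * r - (dist v z + dist w z - dist v w) / 2)"
proof -
  have "prob (uncut v w z r) = exp (- measure \<mu> (cut_off v w z r))"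
    unfolding uncut_def using r
    by (intro prob_no_points bounded_subset[OF bounded_hits cut_off_subset_hits]) auto
  then show ?thesis
    using measure_cut_off_ge[OF r, of v z w] by simp
qed

lemma AE_no_line_thru: "AE \<omega> in M. L \<omega> \<inter> thru x = {}"
proof -
  have "prob {\<omega> \<in> space M. L \<omega> \<inter> thru x = {}} = 1"
    using prob_no_points(2)[of "thru x"] bounded_subset[OF bounded_hits thru_subset_hits, of x] by simp
  moreover have "{\<omega> \<in> space M. L \<omega> \<inter> thru x = {}} \<in> events"
    using prob_no_points(1)[of "thru x"] bounded_subset[OF bounded_hits thru_subset_hits, of x] by simp
  ultimately have "AE \<omega> in M. \<omega> \<in> {\<omega> \<in> space M. L \<omega> \<inter> thru x = {}}"
    using prob_eq_1 by blast
  then show ?thesis by simp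
qed

end

section \<open>The cell of two points as an intersection of half-planes\<close>

lemma convex_side: "convex {x. side p x * k > 0}"
proof (rule convexI)
  fix x y :: "real^2" and a b :: real
  assume xy: "x \<in> {x. side p x * k > 0}" "y \<in> {x. side p x * k > 0}" and ab: "0 \<le> a" "0 \<le> b" "a + b = 1"
  have a: "a = 1 - b" using ab by simp
  have "side p (a *\<^sub>R x + b *\<^sub>R y) * k = a * (side p x * k) + b * (side p y * k)"
    unfolding a side_affine by (simp add: algebra_simps)
  also have "\<dots> > 0"
    using xy ab by (cases "a = 0") (auto intro: add_pos_nonneg)
  finally show "a *\<^sub>R x + b *\<^sub>R y \<in> {x. side p x * k > 0}" by simp
qed

context
  fixes P :: "(real \<times> real) set" and v w :: "real^2"
  assumes P: "P \<subseteq> params" and fin: "\<And>B. bounded B \<Longrightarrow> finite (P \<inter> B)"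
    and no_v: "P \<inter> thru v = {}" and no_w: "P \<inter> thru w = {}"
begin

lemma not_separates_iff: "p \<in> P \<Longrightarrow> \<not> separates (line_of p) v w \<longleftrightarrow> side p w * side p v > 0"
  using P no_v no_w unfolding separates_def line_meets_segment_iff
  by (auto simp: line_of_eq_side thru_def mult.commute not_less)

text \<open>
  The right-hand side is convex, hence connected, and avoids the lines. Conversely the cell is
  connected and avoids the zero set of the continuous function \<open>side p\<close>, which therefore keeps its sign.
\<close>

lemma cell_eq: "cell P v w = (\<Inter>p\<in>{p\<in>P. side p w * side p v > 0}. {x. side p x * side p v > 0})"
  (is "_ = \<Inter> (?H ` ?N)")
proof -
  have cell: "cell P v w = connected_component_set (- (\<Union>p\<in>?N. line_of p)) v"
    unfolding cell_def using not_separates_iff by (metis (mono_tags, lifting) Collect_cong)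
  have v: "side p v \<noteq> 0" if "p \<in> P" for p
    using that P no_v by (auto simp: thru_def)
  show ?thesis
  proof (intro equalityI subsetI INT_I)
    fix x p assume x: "x \<in> cell P v w" and p: "p \<in> ?N"
    define C where "C = cell P v w"
    have con: "connected C" unfolding C_def cell by simp
    have "v \<in> - (\<Union>p\<in>?N. line_of p)" using v by (auto simp: line_of_eq_side)
    then have "v \<in> C" unfolding C_def cell by (simp add: connected_component_refl)
    have "x \<in> C" using x by (simp add: C_def)
    have not0: "side p y \<noteq> 0" if "y \<in> C" for y
      using that p connected_component_subset[of "- (\<Union>p\<in>?N. line_of p)" v]
      unfolding C_def cell by (auto simp: line_of_eq_side)
    have "connected (side p ` C)"
      by (intro connected_continuous_image continuous_on_side_point con)
    then have "{min (side p x) (side p v)..max (side p x) (side p v)} \<subseteq> side p ` C"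
      using \<open>v \<in> C\<close> \<open>x \<in> C\<close> by (intro connected_contains_Icc) (auto simp: min_def max_def)
    then have "\<not> (min (side p x) (side p v) \<le> 0 \<and> 0 \<le> max (side p x) (side p v))"
      using not0 by force
    then show "x \<in> ?H p" by (auto simp: zero_less_mult_iff)
  next
    fix x assume x: "x \<in> \<Inter> (?H ` ?N)"
    have "convex (\<Inter> (?H ` ?N))" by (intro convex_INT convex_side)
    then have "\<Inter> (?H ` ?N) \<subseteq> cell P v w"
      unfolding cell using v
      by (intro connected_component_maximal convex_connected)
         (auto simp: line_of_eq_side zero_less_mult_iff less_le)
    then show "x \<in> cell P v w" using x by blast
  qed
qed

lemma convex_cell: "convex (cell P v w)"
  unfolding cell_eq by (intro convex_INT convex_side)

lemma in_cell: "v \<in> cell P v w" "w \<in> cell P v w"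
  unfolding cell_eq using P no_v by (auto simp: thru_def zero_less_mult_iff less_le)

text \<open>
  Only finitely many lines come close to a given point, so the union of the lines is closed.
\<close>

lemma open_cell: "open (cell P v w)"
  unfolding cell_def
proof (intro open_connected_component open_Compl)
  define N where "N = {p \<in> P. \<not> separates (line_of p) v w}"
  have "closedin euclidean (\<Union> (line_of ` N))"
  proof (rule closedin_locally_finite_Union)
    fix S assume "S \<in> line_of ` N"
    then obtain p where "S = line_of p" by blast
    then have "S = side p -` {0}" by (auto simp: line_of_eq_side)
    then show "closedin euclidean S"
      using continuous_closed_vimage[of "{0}" "side p"] continuous_on_side_point[of UNIV p]
      by (auto simp: continuous_on_eq_continuous_at)
  next
    show "locally_finite_in euclidean (line_of ` N)"
      unfolding locally_finite_in_def
    proof (intro conjI ballI)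
      fix x :: "real^2"
      have "{U \<in> line_of ` N. U \<inter> ball x 1 \<noteq> {}} \<subseteq> line_of ` (P \<inter> near x 1)"
      proof
        fix U assume "U \<in> {U \<in> line_of ` N. U \<inter> ball x 1 \<noteq> {}}"
        then obtain p where p: "p \<in> N" "U = line_of p" "line_of p \<inter> ball x 1 \<noteq> {}" by blast
        then obtain y where y: "side p y = 0" "dist x y < 1"
          by (auto simp: line_of_eq_side)
        moreover have "p \<in> params" using p(1) P by (auto simp: N_def)
        ultimately have "p \<in> near x 1"
          using side_diff_le[of p x y] by (simp add: near_def)
        then show "U \<in> line_of ` (P \<inter> near x 1)"
          using p by (auto simp: N_def)
      qed
      moreover have "finite (P \<inter> near x 1)"
        by (intro fin bounded_subset[OF bounded_near near_subset_near_0])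
      ultimately have "finite {U \<in> line_of ` N. U \<inter> ball x 1 \<noteq> {}}"
        using finite_subset by blast
      then show "\<exists>V. openin euclidean V \<and> x \<in> V \<and> finite {U \<in> line_of ` N. U \<inter> V \<noteq> {}}"
        by (intro exI[of _ "ball x 1"]) auto
    qed auto
  qed
  then show "closed (\<Union>p\<in>{p \<in> P. \<not> separates (line_of p) v w}. line_of p)"
    by (simp add: N_def)
qed

lemma no_cut_off_if_cell_meets:
  assumes "y \<in> cell P v w" "dist y z \<le> r"
  shows "P \<inter> cut_off v w z r = {}"
proof (rule ccontr)
  assume "P \<inter> cut_off v w z r \<noteq> {}"
  then obtain p where p: "p \<in> P" "p \<in> cut_off v w z r" by blast
  then have "side p w * side p v > 0" by (auto simp: cut_off_def zero_less_mult_iff)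
  then have "side p y * side p v > 0"
    using assms(1) p(1) unfolding cell_eq by blast
  then show False
    using p(2) side_diff_le[of p y z] assms(2) by (auto simp: cut_off_def zero_less_mult_iff)
qed

end

section \<open>Expected perimeter\<close>

lemma suminf_ennreal_geometric:
  assumes "0 \<le> c" "0 < q" "(q::real) < 1"
  shows "(\<Sum>k. ennreal (c * q ^ k)) = ennreal (c / (1 - q))"
proof (rule suminf_ennreal_eq)
  show "(\<lambda>k. c * q ^ k) sums (c / (1 - q))"
    using sums_mult[OF geometric_sums[of q], of c] assms by simp
qed (use assms in auto)

lemma exp_neg_eq_power: "exp (- (real j / c)) = exp (- (1 / c)) ^ j"
  by (simp add: field_simps flip: exp_of_nat_mult)

lemma finite_net_sphere:
  assumes "0 < \<epsilon>"
  obtains F :: "(real^2) set" where "finite F" "F \<subseteq> sphere 0 1"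
    "\<And>d. norm d = 1 \<Longrightarrow> \<exists>f\<in>F. dist d f \<le> \<epsilon>"
proof -
  have sphere: "compact (sphere 0 1 :: (real^2) set)" by simp
  have cover: "sphere 0 1 \<subseteq> (\<Union>d\<in>sphere 0 1. ball (d :: real^2) \<epsilon>)"
    using assms by (auto simp del: mem_sphere intro!: bexI)
  obtain F where F: "F \<subseteq> sphere 0 1" "finite F" "sphere 0 1 \<subseteq> (\<Union>d\<in>F. ball (d :: real^2) \<epsilon>)"
    by (rule compactE_image[OF sphere _ cover]) auto
  have "\<exists>f\<in>F. dist d f \<le> \<epsilon>" if "norm d = 1" for d
  proof -
    have "d \<in> sphere 0 1" using that by simp
    then have "d \<in> (\<Union>d\<in>F. ball d \<epsilon>)" using F(3) by blast
    then show ?thesis by (auto simp: dist_commute intro: less_imp_le)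
  qed
  then show thesis using that F by blast
qed

context unit_poisson_line_process
begin

lemma uncut_commute: "uncut v w z r = uncut w v z r"
proof -
  have "cut_off v w z r = cut_off w v z r" by (auto simp: cut_off_def)
  then show ?thesis by (simp add: uncut_def)
qed

lemma emeasure_uncut_le:
  assumes "0 \<le> r" "2 * c \<le> dist v z + dist w z - dist v w"
  shows "emeasure M (uncut v w z r) \<le> ennreal (exp (7 / 2 + 8 * r - c))"
  unfolding emeasure_eq_measure
  by (intro ennreal_leI order_trans[OF prob_uncut_le]) (use assms in auto)

text \<open>
  This and the next two definitions are the measurable counterparts of \<open>section_bound\<close>, \<open>cap_bound\<close>
  and \<open>arc_bound\<close>: the event that the cell meets a ball is replaced by the larger event that
  no line of the process cuts the ball off.
\<close>

definition rand_section :: "real^2 \<Rightarrow> real^2 \<Rightarrow> real^2 \<Rightarrow> real^2 \<Rightarrow> real \<Rightarrow> 'a \<Rightarrow> ennreal" where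
  "rand_section v w e u x \<omega> =
     (\<Sum>j. ennreal (2 * real j + 1) * indicator (uncut v w (v + x *\<^sub>R e + (real j * sqrt x) *\<^sub>R u) 0) \<omega>)"

definition rand_cap :: "(real^2) set \<Rightarrow> real^2 \<Rightarrow> real^2 \<Rightarrow> real^2 \<Rightarrow> 'a \<Rightarrow> ennreal" where
  "rand_cap F v w e \<omega> = (\<Sum>k. \<Sum>d\<in>{d\<in>F. d \<bullet> e \<le> 3 / 4}.
     indicator (uncut v w (v + (real k + 2) *\<^sub>R d) ((real k + 2) / 128)) \<omega>)"

definition rand_arc :: "real^2 \<Rightarrow> real^2 \<Rightarrow> real^2 \<Rightarrow> real^2 \<Rightarrow> real \<Rightarrow> real \<Rightarrow> real \<Rightarrow> 'a \<Rightarrow> ennreal" where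
  "rand_arc v w e u m x x' \<omega> = ennreal (x' - x) + ennreal ((x' - x) / 2) *
     (rand_section v w e u x \<omega> * ennreal (1 / x)
      + rand_section w v (- e) u (m - x') \<omega> * ennreal (1 / (m - x')))"

lemma measurable_rand [measurable]:
  "rand_section v w e u x \<in> borel_measurable M"
  "rand_cap F v w e \<in> borel_measurable M"
  "rand_arc v w e u m x x' \<in> borel_measurable M"
proof -
  have i: "r \<ge> 0 \<Longrightarrow> (indicator (uncut v w z r) :: 'a \<Rightarrow> ennreal) \<in> borel_measurable M" for v w z r
    by (intro borel_measurable_indicator sets_uncut)
  show 1: "rand_section v w e u x \<in> borel_measurable M" for v w e u x
    unfolding rand_section_def by (intro borel_measurable_suminf_order borel_measurable_times i) auto
  show "rand_cap F v w e \<in> borel_measurable M"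
    unfolding rand_cap_def by (intro borel_measurable_suminf_order borel_measurable_sum i) auto
  show "rand_arc v w e u m x x' \<in> borel_measurable M"
    unfolding rand_arc_def using 1 by measurable
qed

definition section_mean :: real where
  "section_mean = 24 * exp (7 / 2) / (1 - exp (- (1 / 12)))"

definition cap_mean :: "(real^2) set \<Rightarrow> real" where
  "cap_mean F = real (card F) * exp (7 / 2) / (1 - exp (- (1 / 16)))"

lemma means_nonneg: "0 \<le> section_mean" "0 \<le> cap_mean F"
  by (simp_all add: section_mean_def cap_mean_def)

text \<open>
  The distance from \<open>v\<close> to the \<open>j\<close>-th grid point over \<open>x\<close>: although the heights are multiples of
  \<open>sqrt x\<close> only, the detour over it grows linearly in \<open>j\<close>, uniformly in \<open>x\<close>.
\<close>

lemma sqrt_add_ge: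
  assumes "1 \<le> x"
  shows "x + real j / 3 \<le> sqrt (x\<^sup>2 + (real j * sqrt x)\<^sup>2)"
proof (rule real_le_rsqrt)
  have "real j * real j \<ge> real j" by (cases j) auto
  then have "real j * x \<le> (real j * real j) * x" using assms by (intro mult_right_mono) auto
  moreover have "real j * real j * 1 \<le> real j * real j * x" using assms by (intro mult_left_mono) auto
  moreover have "(x + real j / 3)\<^sup>2 = x\<^sup>2 + 2 / 3 * (real j * x) + real j * real j * 1 / 9"
    by (simp add: power2_eq_square field_simps)
  ultimately have "(x + real j / 3)\<^sup>2 \<le> x\<^sup>2 + (real j * real j) * x"
    using mult_nonneg_nonneg[of "real j" x] assms by linarith
  then show "(x + real j / 3)\<^sup>2 \<le> x\<^sup>2 + (real j * sqrt x)\<^sup>2"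
    using assms by (simp add: power_mult_distrib power2_eq_square[of "real j"])
qed

text \<open>
  The detour from \<open>v\<close> to \<open>w\<close> over the \<open>j\<close>-th grid point exceeds \<open>m\<close> by at least \<open>j / 3\<close>, so the
  point is not cut off with probability at most a constant times \<open>exp (- j / 6)\<close>. Half of that decay
  absorbs the weight \<open>2 j + 1\<close>, and a geometric series remains.
\<close>

lemma nn_integral_rand_section_le:
  assumes e: "norm e = 1" "norm u = 1" "e \<bullet> u = 0" and w: "w = v + m *\<^sub>R e" and x: "1 \<le> x" "0 \<le> m"
  shows "(\<integral>\<^sup>+\<omega>. rand_section v w e u x \<omega> \<partial>M) \<le> ennreal section_mean"
proof -
  define z where "z j = v + x *\<^sub>R e + (real j * sqrt x) *\<^sub>R u" for j :: nat
  have ee: "e \<bullet> e = 1" "u \<bullet> u = 1" "u \<bullet> e = 0"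
    using e by (simp_all add: norm_eq_1 inner_commute)
  have "(\<integral>\<^sup>+\<omega>. rand_section v w e u x \<omega> \<partial>M) = (\<Sum>j. ennreal (2 * real j + 1) * emeasure M (uncut v w (z j) 0))"
    unfolding rand_section_def z_def[symmetric]
    by (subst nn_integral_suminf) (auto simp: nn_integral_cmult_indicator intro!: borel_measurable_times)
  also have "\<dots> \<le> (\<Sum>j. ennreal (24 * exp (7 / 2) * exp (- (1 / 12)) ^ j))"
  proof (intro suminf_le)
    fix j :: nat
    have "dist v (z j) = sqrt (x\<^sup>2 + (real j * sqrt x)\<^sup>2)"
      by (simp add: z_def dist_norm norm_eq_sqrt_inner inner_diff_left inner_diff_right inner_add_left inner_add_right
          ee e(3) power2_eq_square)
    then have "x + real j / 3 \<le> dist v (z j)" using sqrt_add_ge[OF x(1), of j] by simp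
    moreover have "m - x \<le> dist w (z j)"
    proof -
      have "m - x = (w - z j) \<bullet> e"
        by (simp add: w z_def inner_diff_left inner_add_left ee)
      also have "\<dots> \<le> dist w (z j)"
        using norm_cauchy_schwarz[of "w - z j" e] e by (simp add: dist_norm)
      finally show ?thesis .
    qed
    moreover have "dist v w = m" using x e by (simp add: w dist_norm)
    ultimately have "2 * (real j / 6) \<le> dist v (z j) + dist w (z j) - dist v w" by linarith
    then have "emeasure M (uncut v w (z j) 0) \<le> ennreal (exp (7 / 2 + 8 * 0 - real j / 6))"
      by (intro emeasure_uncut_le) auto
    then have "ennreal (2 * real j + 1) * emeasure M (uncut v w (z j) 0)
        \<le> ennreal (2 * real j + 1) * ennreal (exp (7 / 2 - real j / 6))"
      by (intro mult_left_mono) auto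
    also have "\<dots> = ennreal ((2 * real j + 1) * exp (7 / 2 - real j / 6))"
      by (simp add: ennreal_mult)
    also have "\<dots> \<le> ennreal (24 * exp (real j / 12) * exp (7 / 2 - real j / 6))"
    proof (intro ennreal_leI mult_right_mono)
      show "2 * real j + 1 \<le> 24 * exp (real j / 12)"
        using exp_ge_add_one_self[of "real j / 12"] by linarith
    qed auto
    also have "24 * exp (real j / 12) * exp (7 / 2 - real j / 6) = 24 * exp (7 / 2) * exp (- (1 / 12)) ^ j"
      unfolding exp_neg_eq_power[symmetric] by (simp flip: exp_add)
    finally show "ennreal (2 * real j + 1) * emeasure M (uncut v w (z j) 0)
      \<le> ennreal (24 * exp (7 / 2) * exp (- (1 / 12)) ^ j)" .
  qed auto
  also have "\<dots> = ennreal section_mean"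
    unfolding section_mean_def by (rule suminf_ennreal_geometric) auto
  finally show ?thesis .
qed

text \<open>
  In a direction \<open>d\<close> with \<open>d \<bullet> e \<le> 3 / 4\<close> the detour over \<open>v + r d\<close> exceeds \<open>m\<close> by at least \<open>r / 4\<close>,
  which yields a decay rate \<open>1 / 8\<close>. The ball of radius \<open>r / 128\<close> about that point costs
  \<open>8 r / 128 = r / 16\<close>, half of it.
\<close>

lemma nn_integral_rand_cap_le:
  assumes e: "norm e = 1" and F: "finite F" "F \<subseteq> sphere 0 1" and w: "w = v + m *\<^sub>R e" and m: "0 \<le> m"
  shows "(\<integral>\<^sup>+\<omega>. rand_cap F v w e \<omega> \<partial>M) \<le> ennreal (cap_mean F)"
proof -
  define D where "D = {d\<in>F. d \<bullet> e \<le> 3 / 4}"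
  define z where "z k d = v + (real k + 2) *\<^sub>R d" for k :: nat and d :: "real^2"
  have ee: "e \<bullet> e = 1" using e by (simp add: norm_eq_1)
  have "(\<integral>\<^sup>+\<omega>. rand_cap F v w e \<omega> \<partial>M) = (\<Sum>k. \<Sum>d\<in>D. emeasure M (uncut v w (z k d) ((real k + 2) / 128)))"
    unfolding rand_cap_def z_def[symmetric] D_def[symmetric]
    by (subst nn_integral_suminf) (auto simp: nn_integral_sum)
  also have "\<dots> \<le> (\<Sum>k. ennreal (real (card F) * exp (7 / 2) * exp (- (1 / 16)) ^ k))"
  proof (intro suminf_le)
    fix k :: nat
    define r where "r = real k + 2"
    have "emeasure M (uncut v w (z k d) (r / 128)) \<le> ennreal (exp (7 / 2 + 8 * (r / 128) - r / 8))" if d: "d \<in> D" for d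
    proof (rule emeasure_uncut_le)
      have "norm d = 1" using d F by (auto simp: D_def)
      then have "dist v (z k d) = r" by (simp add: z_def dist_norm r_def)
      moreover have "m - r * (d \<bullet> e) \<le> dist w (z k d)"
      proof -
        have "m - r * (d \<bullet> e) = (w - z k d) \<bullet> e"
          by (simp add: w z_def r_def inner_diff_left inner_add_left ee)
        also have "\<dots> \<le> dist w (z k d)"
          using norm_cauchy_schwarz[of "w - z k d" e] e by (simp add: dist_norm)
        finally show ?thesis .
      qed
      moreover have "r * (d \<bullet> e) \<le> r * (3 / 4)"
        using d by (intro mult_left_mono) (auto simp: D_def r_def)
      moreover have "dist v w = m" using m e by (simp add: w dist_norm)
      ultimately show "2 * (r / 8) \<le> dist v (z k d) + dist w (z k d) - dist v w" by linarith
    qed (simp add: r_def)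
    moreover have "exp (7 / 2 + 8 * (r / 128) - r / 8) \<le> exp (7 / 2) * exp (- (1 / 16)) ^ k"
    proof -
      have "7 / 2 + 8 * (r / 128) - r / 8 \<le> 7 / 2 + - (real k / 16)"
        by (simp add: r_def field_simps)
      then show ?thesis
        unfolding exp_neg_eq_power[symmetric] exp_add[symmetric] by simp
    qed
    ultimately have le: "emeasure M (uncut v w (z k d) (r / 128)) \<le> ennreal (exp (7 / 2) * exp (- (1 / 16)) ^ k)"
      if "d \<in> D" for d
      using that ennreal_leI order_trans by blast
    have "(\<Sum>d\<in>D. emeasure M (uncut v w (z k d) (r / 128))) \<le> (\<Sum>d\<in>D. ennreal (exp (7 / 2) * exp (- (1 / 16)) ^ k))"
      using le by (rule sum_mono)
    also have "\<dots> \<le> (\<Sum>d\<in>F. ennreal (exp (7 / 2) * exp (- (1 / 16)) ^ k))"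
      using F by (intro sum_mono2) (auto simp: D_def)
    also have "\<dots> = ennreal (real (card F) * (exp (7 / 2) * exp (- (1 / 16)) ^ k))"
      by (simp add: ennreal_mult ennreal_of_nat_eq_real_of_nat)
    finally show "(\<Sum>d\<in>D. emeasure M (uncut v w (z k d) ((real k + 2) / 128)))
      \<le> ennreal (real (card F) * exp (7 / 2) * exp (- (1 / 16)) ^ k)"
      by (simp add: r_def mult.assoc)
  qed auto
  also have "\<dots> = ennreal (cap_mean F)"
    unfolding cap_mean_def by (rule suminf_ennreal_geometric) auto
  finally show ?thesis .
qed

lemma nn_integral_rand_arc_le:
  assumes e: "norm e = 1" "norm u = 1" "e \<bullet> u = 0" and w: "w = v + m *\<^sub>R e"
    and x: "1 \<le> x" "x \<le> x'" "x' \<le> m - 1"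
  shows "(\<integral>\<^sup>+\<omega>. rand_arc v w e u m x x' \<omega> \<partial>M)
    \<le> ennreal ((x' - x) + (x' - x) / 2 * section_mean * (1 / x + 1 / (m - x')))"
proof -
  have "(\<integral>\<^sup>+\<omega>. rand_arc v w e u m x x' \<omega> \<partial>M) = ennreal (x' - x) + ennreal ((x' - x) / 2) *
     ((\<integral>\<^sup>+\<omega>. rand_section v w e u x \<omega> \<partial>M) * ennreal (1 / x)
      + (\<integral>\<^sup>+\<omega>. rand_section w v (- e) u (m - x') \<omega> \<partial>M) * ennreal (1 / (m - x')))"
    unfolding rand_arc_def
    by (simp add: nn_integral_add nn_integral_cmult nn_integral_multc emeasure_space_1)
  also have "\<dots> \<le> ennreal (x' - x) + ennreal ((x' - x) / 2) *
     (ennreal section_mean * ennreal (1 / x) + ennreal section_mean * ennreal (1 / (m - x')))"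
    using e x w
    by (intro add_left_mono mult_left_mono add_mono mult_right_mono
        nn_integral_rand_section_le[of _ _ _ _ m]) auto
  also have "\<dots> = ennreal ((x' - x) + (x' - x) / 2 * (section_mean * (1 / x) + section_mean * (1 / (m - x'))))"
  proof -
    have gen: "ennreal (a + b * (p * c + q * d)) = ennreal a + ennreal b * (ennreal p * ennreal c + ennreal q * ennreal d)"
      if "0 \<le> a" "0 \<le> b" "0 \<le> p" "0 \<le> c" "0 \<le> q" "0 \<le> d" for a b p c q d :: real
      using that by (simp add: ennreal_mult)
    show ?thesis
      using x means_nonneg(1) by (intro gen[symmetric]) auto
  qed
  finally show ?thesis by (simp only: distrib_left mult.assoc)
qed

lemma deterministic_le_rand:
  assumes "\<And>z r. 0 \<le> r \<Longrightarrow> C \<inter> cball z r \<noteq> {} \<Longrightarrow> \<omega> \<in> uncut v w z r"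
  shows "section_bound C v e u x \<le> rand_section v w e u x \<omega>"
    and "cap_bound F C v e \<le> rand_cap F v w e \<omega>"
proof -
  have "of_bool (z \<in> C) \<le> (indicator (uncut v w z 0) \<omega> :: ennreal)" for z
    using assms[of 0 z] by auto
  then show "section_bound C v e u x \<le> rand_section v w e u x \<omega>"
    unfolding section_bound_def rand_section_def by (intro suminf_le mult_left_mono) auto
  have "of_bool (C \<inter> cball z r \<noteq> {}) \<le> (indicator (uncut v w z r) \<omega> :: ennreal)" if "0 \<le> r" for z r
    using assms[OF that, of z] by auto
  then show "cap_bound F C v e \<le> rand_cap F v w e \<omega>"
    unfolding cap_bound_def rand_cap_def by (intro suminf_le sum_mono) auto
qed

lemma cell_bounds:
  assumes \<omega>: "\<omega> \<in> space M" and no: "L \<omega> \<inter> thru v = {}" "L \<omega> \<inter> thru w = {}"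
    and e: "norm e = 1" "norm u = 1" "e \<bullet> u = 0" and w: "w = v + m *\<^sub>R e" and m: "0 < m"
  shows "cell_frame (cell (L \<omega>) v w) v e u m"
    and "0 \<le> r \<Longrightarrow> cell (L \<omega>) v w \<inter> cball z r \<noteq> {} \<Longrightarrow> \<omega> \<in> uncut v w z r"
proof -
  note P = lines_in_params[OF \<omega>] locally_finite[OF \<omega>] no
  show "cell_frame (cell (L \<omega>) v w) v e u m"
    using open_cell[OF P] convex_cell[OF P] in_cell[OF P] e m
    by unfold_locales (auto simp: w)
  show "\<omega> \<in> uncut v w z r" if "0 \<le> r" and meets: "cell (L \<omega>) v w \<inter> cball z r \<noteq> {}"
  proof -
    obtain y where "y \<in> cell (L \<omega>) v w" "dist y z \<le> r" using meets by (auto simp: dist_commute)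
    then have "L \<omega> \<inter> cut_off v w z r = {}"
      by (intro no_cut_off_if_cell_meets[of "L \<omega>" v w y] P) auto
    then show ?thesis using \<omega> by (simp add: uncut_def)
  qed
qed

text \<open>
  The sum of the terms with \<open>i > 0\<close> is a lower Riemann sum of \<open>1 / x\<close> with mesh \<open>h\<close>.
\<close>

lemma sum_inverse_grid_le:
  assumes "0 < h" "h \<le> (1::real)"
  shows "(\<Sum>i<Suc n. h / (1 + real i * h)) \<le> 1 + ln (1 + real n * h)"
proof (induction n)
  case (Suc n)
  define a where "a = 1 + real n * h"
  have a: "0 < a" using assms by (simp add: a_def add_pos_nonneg)
  have "ln a - ln (a + h) \<le> (a - (a + h)) / (a + h)"
    using a assms by (intro ln_diff_le) auto
  then have "h / (a + h) \<le> ln (a + h) - ln a" by (simp add: minus_divide_left[symmetric])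
  moreover have "1 + real (Suc n) * h = a + h" by (simp add: a_def algebra_simps)
  ultimately show ?case using Suc.IH unfolding sum.lessThan_Suc[of _ "Suc n"] a_def[symmetric] by simp
qed (use assms in auto)

text \<open>
  The interval \<open>[1, m - 1]\<close> is divided into equal pieces of length at most one. The grid is symmetric,
  so that the terms with \<open>1 / (m - x)\<close> sum to the same value as those with \<open>1 / x\<close>.
\<close>

lemma mean_perimeter_le:
  assumes F: "finite F" "F \<subseteq> sphere 0 1" "\<And>d. norm d = 1 \<Longrightarrow> \<exists>f\<in>F. dist d f \<le> 1 / 128"
    and m: "dist v w = m" "2 < m"
  shows "(\<integral>\<^sup>+\<omega>. hausdorff1 (frontier (cell (L \<omega>) v w)) \<partial>M)
    \<le> ennreal (2 * m + 4 * pi * (2 + cap_mean F) + 2 * section_mean * (1 + ln m))"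
proof -
  define e where "e = (1 / m) *\<^sub>R (w - v)"
  define u :: "real^2" where "u = vector [- e$2, e$1]"
  have w: "w = v + m *\<^sub>R e" and e: "norm e = 1"
    using m by (simp_all add: e_def dist_norm norm_minus_commute)
  have u: "norm u = 1" "e \<bullet> u = 0" "e \<bullet> (- u) = 0" "norm (- u) = 1" "norm (- e) = 1" "- e \<bullet> u = 0"
    using e by (simp_all add: u_def norm_eq_sqrt_inner inner_vec_def sum_2 add.commute)
  have v: "v = w + m *\<^sub>R (- e)" by (simp add: w)
  define n where "n = nat \<lceil>m - 2\<rceil>"
  have n: "0 < n" "m - 2 \<le> real n" using m unfolding n_def by linarith+
  define h where "h = (m - 2) / real n"
  have h: "0 < h" "h \<le> 1" "real n * h = m - 2" using n m by (simp_all add: h_def)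
  define x where "x i = 1 + real i * h" for i :: nat
  have xi: "1 \<le> x i" "x i \<le> x (Suc i)" "x (Suc i) \<le> m - 1" "x (Suc i) - x i = h" if "i < n" for i
  proof -
    have "real (Suc i) * h \<le> real n * h" using that h by (intro mult_right_mono) auto
    then show "1 \<le> x i" "x i \<le> x (Suc i)" "x (Suc i) \<le> m - 1" "x (Suc i) - x i = h"
      using h by (auto simp: x_def algebra_simps)
  qed
  define R where "R \<omega> = ennreal (2 * pi) * (2 + rand_cap F v w e \<omega>) + ennreal (2 * pi) * (2 + rand_cap F w v (- e) \<omega>)
     + (\<Sum>i<n. rand_arc v w e u m (x i) (x (Suc i)) \<omega> + rand_arc v w e (- u) m (x i) (x (Suc i)) \<omega>)" for \<omega>
  have "AE \<omega> in M. hausdorff1 (frontier (cell (L \<omega>) v w)) \<le> R \<omega>"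
    using AE_no_line_thru[of v] AE_no_line_thru[of w] AE_space
  proof eventually_elim
    case (elim \<omega>)
    interpret cf: cell_frame "cell (L \<omega>) v w" v e u m
      by (rule cell_bounds(1)[OF elim(3,1,2) e u(1,2) w]) (use m in simp)
    have un: "\<omega> \<in> uncut v w z r" if "0 \<le> r" "cell (L \<omega>) v w \<inter> cball z r \<noteq> {}" for z r
      by (rule cell_bounds(2)[OF elim(3,1,2) e u(1,2) w _ that]) (use m in simp)
    then have un': "\<omega> \<in> uncut w v z r" if "0 \<le> r" "cell (L \<omega>) v w \<inter> cball z r \<noteq> {}" for z r
      using that by (simp add: uncut_commute[of w])
    have arc: "arc_bound (cell (L \<omega>) v w) v e u' m a b \<le> rand_arc v w e u' m a b \<omega>" for u' a b
      unfolding arc_bound_def rand_arc_def w[symmetric]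
      by (intro add_left_mono mult_left_mono add_mono mult_right_mono deterministic_le_rand un un') auto
    have "hausdorff1 (frontier (cell (L \<omega>) v w)) \<le>
      ennreal (2 * pi) * (2 + cap_bound F (cell (L \<omega>) v w) v e)
      + ennreal (2 * pi) * (2 + cap_bound F (cell (L \<omega>) v w) w (- e))
      + (\<Sum>i<n. arc_bound (cell (L \<omega>) v w) v e u m (x i) (x (Suc i))
           + arc_bound (cell (L \<omega>) v w) v e (- u) m (x i) (x (Suc i)))"
      using cf.hausdorff1_frontier_le[OF F(1,3) m(2) n(1) h_def, of x] unfolding w[symmetric] by (simp add: x_def)
    also have "\<dots> \<le> R \<omega>"
      unfolding R_def
      by (intro add_mono mult_left_mono add_left_mono sum_mono deterministic_le_rand arc un un') auto
    finally show ?case .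
  qed
  then have "(\<integral>\<^sup>+\<omega>. hausdorff1 (frontier (cell (L \<omega>) v w)) \<partial>M) \<le> (\<integral>\<^sup>+\<omega>. R \<omega> \<partial>M)"
    by (rule nn_integral_mono_AE)
  also have "\<dots> = ennreal (2 * pi) * (2 + (\<integral>\<^sup>+\<omega>. rand_cap F v w e \<omega> \<partial>M))
     + ennreal (2 * pi) * (2 + (\<integral>\<^sup>+\<omega>. rand_cap F w v (- e) \<omega> \<partial>M))
     + (\<Sum>i<n. (\<integral>\<^sup>+\<omega>. rand_arc v w e u m (x i) (x (Suc i)) \<omega> \<partial>M)
            + (\<integral>\<^sup>+\<omega>. rand_arc v w e (- u) m (x i) (x (Suc i)) \<omega> \<partial>M))"
    unfolding R_def by (simp add: nn_integral_add nn_integral_cmult nn_integral_sum emeasure_space_1)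
  also have "\<dots> \<le> ennreal (2 * pi) * (2 + ennreal (cap_mean F)) + ennreal (2 * pi) * (2 + ennreal (cap_mean F))
     + (\<Sum>i<n. ennreal (h + h / 2 * section_mean * (1 / x i + 1 / x (n - Suc i)))
            + ennreal (h + h / 2 * section_mean * (1 / x i + 1 / x (n - Suc i))))"
  proof (intro add_mono mult_left_mono sum_mono order_refl)
    show "(\<integral>\<^sup>+\<omega>. rand_cap F v w e \<omega> \<partial>M) \<le> ennreal (cap_mean F)"
      by (rule nn_integral_rand_cap_le[OF e F(1,2) w]) (use m in simp)
    show "(\<integral>\<^sup>+\<omega>. rand_cap F w v (- e) \<omega> \<partial>M) \<le> ennreal (cap_mean F)"
      by (rule nn_integral_rand_cap_le[OF u(5) F(1,2) v]) (use m in simp)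
    fix i assume "i \<in> {..<n}"
    then have i: "i < n" by simp
    have eq: "m - x (Suc i) = x (n - Suc i)"
      using i h(3) by (simp add: x_def of_nat_diff algebra_simps)
    have arc: "(\<integral>\<^sup>+\<omega>. rand_arc v w e u' m (x i) (x (Suc i)) \<omega> \<partial>M)
        \<le> ennreal (h + h / 2 * section_mean * (1 / x i + 1 / x (n - Suc i)))"
      if "norm u' = 1" "e \<bullet> u' = 0" for u'
      using nn_integral_rand_arc_le[OF e that w xi(1-3)[OF i]] unfolding xi(4)[OF i] eq .
    show "(\<integral>\<^sup>+\<omega>. rand_arc v w e u m (x i) (x (Suc i)) \<omega> \<partial>M)
        \<le> ennreal (h + h / 2 * section_mean * (1 / x i + 1 / x (n - Suc i)))"
      by (rule arc[OF u(1,2)])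
    show "(\<integral>\<^sup>+\<omega>. rand_arc v w e (- u) m (x i) (x (Suc i)) \<omega> \<partial>M)
        \<le> ennreal (h + h / 2 * section_mean * (1 / x i + 1 / x (n - Suc i)))"
      by (rule arc[OF u(4,3)])
  qed auto
  also have "\<dots> = ennreal (4 * pi * (2 + cap_mean F)
     + (\<Sum>i<n. 2 * h + h * section_mean * (1 / x i + 1 / x (n - Suc i))))"
  proof -
    have x0: "0 \<le> x i" for i using h by (simp add: x_def)
    define a where "a i = h + h / 2 * section_mean * (1 / x i + 1 / x (n - Suc i))" for i
    have a: "0 \<le> a i" for i using x0 h means_nonneg by (simp add: a_def)
    have cap: "ennreal (2 * pi) * (2 + ennreal (cap_mean F)) = ennreal (2 * pi * (2 + cap_mean F))"
      using means_nonneg(2)[of F] by (simp add: ennreal_mult)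
    have "(\<Sum>i<n. ennreal (a i) + ennreal (a i)) = ennreal (\<Sum>i<n. a i + a i)"
      using a by (simp flip: ennreal_plus add: sum_ennreal)
    moreover have "(\<Sum>i<n. a i + a i) = (\<Sum>i<n. 2 * h + h * section_mean * (1 / x i + 1 / x (n - Suc i)))"
      by (intro sum.cong refl) (simp add: a_def)
    moreover have "0 \<le> (\<Sum>i<n. a i + a i)" using a by (intro sum_nonneg) auto
    ultimately show ?thesis
      unfolding cap a_def[symmetric] using means_nonneg(2)[of F]
      by (simp flip: ennreal_plus)
  qed
  also have "\<dots> \<le> ennreal (2 * m + 4 * pi * (2 + cap_mean F) + 2 * section_mean * (1 + ln m))"
  proof (rule ennreal_leI)
    have "(\<Sum>i<n. 1 / x (n - Suc i)) = (\<Sum>i<n. 1 / x i)"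
      by (rule sum.nat_diff_reindex)
    then have "(\<Sum>i<n. 2 * h + h * section_mean * (1 / x i + 1 / x (n - Suc i)))
      = 2 * (real n * h) + h * section_mean * (2 * (\<Sum>i<n. 1 / x i))"
      by (simp add: sum.distrib flip: sum_distrib_left)
    also have "\<dots> = 2 * (m - 2) + 2 * section_mean * (\<Sum>i<n. h / x i)"
      unfolding h(3) by (simp add: sum_distrib_left mult_ac)
    also have "\<dots> \<le> 2 * (m - 2) + 2 * section_mean * (1 + ln m)"
    proof (intro add_left_mono mult_left_mono)
      obtain k where k: "n = Suc k" using n by (cases n) auto
      have "(\<Sum>i<n. h / x i) \<le> 1 + ln (1 + real k * h)"
        unfolding k x_def by (rule sum_inverse_grid_le[OF h(1,2)])
      also have "\<dots> \<le> 1 + ln m"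
      proof -
        have "1 + real k * h \<le> m" using h k by (simp add: algebra_simps)
        moreover have "0 < 1 + real k * h" using h by (simp add: add_pos_nonneg)
        ultimately show ?thesis by simp
      qed
      finally show "(\<Sum>i<n. h / x i) \<le> 1 + ln m" .
    qed (use means_nonneg in simp)
    finally have le: "(\<Sum>i<n. 2 * h + h * section_mean * (1 / x i + 1 / x (n - Suc i)))
      \<le> 2 * (m - 2) + 2 * section_mean * (1 + ln m)" .
    have "a + s \<le> 2 * m + a + b" if "s \<le> 2 * (m - 2) + b" for a b s :: real
      using that by (simp add: algebra_simps)
    from this[OF le] show "4 * pi * (2 + cap_mean F) + (\<Sum>i<n. 2 * h + h * section_mean * (1 / x i + 1 / x (n - Suc i)))
      \<le> 2 * m + 4 * pi * (2 + cap_mean F) + 2 * section_mean * (1 + ln m)" .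
  qed
  finally show ?thesis .
qed

end

theorem theorem4:
  fixes M :: "'w measure" and \<mu> :: "(real \<times> real) measure" and L :: "'w \<Rightarrow> (real \<times> real) set"
  assumes "stationary_isotropic_poisson_line_process M \<mu> L"
    and "unit_intensity M L"
  shows "\<exists>C::real. \<forall>\<^sub>F m in at_top. \<forall>v w :: real^2. dist v w = m \<longrightarrow>
           mean_perimeter_excess M L v w \<le> ereal (C * ln m)"
proof -
  interpret unit_poisson_line_process M \<mu> L
    using assms by (simp add: unit_poisson_line_process_def unit_poisson_line_process_axioms_def)
  obtain F :: "(real^2) set" where F: "finite F" "F \<subseteq> sphere 0 1"
    "\<And>d. norm d = 1 \<Longrightarrow> \<exists>f\<in>F. dist d f \<le> 1 / 128"
    by (rule finite_net_sphere[of "1 / 128"]) auto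
  define K where "K = 4 * pi * (2 + cap_mean F)"
  have K: "0 \<le> K" using means_nonneg(2)[of F] by (simp add: K_def)
  have excess: "mean_perimeter_excess M L v w \<le> ereal ((K + 4 * section_mean) * ln m)"
    if m: "exp 1 \<le> m" and vw: "dist v w = m" for v w :: "real^2" and m
  proof -
    have m2: "2 < m"
      using m exp_lower_Taylor_quadratic[of "1::real"] by simp
    have ln1: "1 \<le> ln m"
      using m m2 by (simp add: ln_ge_iff)
    have "(\<integral>\<^sup>+\<omega>. hausdorff1 (frontier (cell (L \<omega>) v w)) \<partial>M) \<le> ennreal (2 * m + K + 2 * section_mean * (1 + ln m))"
      unfolding K_def by (rule mean_perimeter_le[OF F vw m2])
    also have "\<dots> \<le> ennreal (2 * m + (K + 4 * section_mean) * ln m)"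
    proof (rule ennreal_leI)
      have "K * 1 \<le> K * ln m" using K ln1 by (intro mult_left_mono)
      moreover have "section_mean * 1 \<le> section_mean * ln m"
        using means_nonneg ln1 by (intro mult_left_mono)
      ultimately show "2 * m + K + 2 * section_mean * (1 + ln m) \<le> 2 * m + (K + 4 * section_mean) * ln m"
        by (simp add: algebra_simps)
    qed
    finally have "enn2ereal (\<integral>\<^sup>+\<omega>. hausdorff1 (frontier (cell (L \<omega>) v w)) \<partial>M)
        \<le> enn2ereal (ennreal (2 * m + (K + 4 * section_mean) * ln m))"
      by (simp add: less_eq_ennreal.rep_eq)
    also have "\<dots> = ereal (2 * m + (K + 4 * section_mean) * ln m)"
      using m2 ln1 K means_nonneg by (intro enn2ereal_ennreal add_nonneg_nonneg mult_nonneg_nonneg) auto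
    finally show ?thesis
      unfolding mean_perimeter_excess_def vw by (simp add: ereal_minus_le_iff add.commute)
  qed
  show ?thesis
    by (intro exI[of _ "K + 4 * section_mean"] eventually_mono[OF eventually_ge_at_top[of "exp 1"]])
       (use excess in blast)
qed

end
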